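(* Let $(V,\mathcal H,\iota,W)$ be an abelian functional theory with set of weights $\Omega$. Let $F$ be a facet of the convex polytope $\mathrm{conv}(\Omega)$, let $\Omega_F:=\Omega\cap F$, and let $\rho_*\in F$ be a density that does not belong to the convex hull of any $\dim F$ weights in $\Omega_F$. Let $\eta\in\overrightarrow{\mathrm{aff}(\Omega)}$ be inward-pointing, i.e. $\rho_*+\epsilon\eta\in\mathrm{conv}(\Omega)$ for all sufficiently small $\epsilon\ge 0$, and let $S\in V$ satisfy $\langle \alpha,S\rangle=0$ for all $\alpha\in\overrightarrow{\mathrm{aff}(F)}$ and $\langle\eta,S\rangle=1$. Then for any $\gamma\in\mathrm{aff}(F)$, $$\lim_{\epsilon\to0^+}\frac{\mathcal F_p(\rho_*+\epsilon\eta)-\mathcal F_p(\rho_* )}{\sqrt\epsilon}=-2\left[\sum_{\omega\in\Omega\setminus\Omega_F}\frac{\lVert\Pi_\omega W|\Phi\rangle\rVert^2}{\langle\omega,S\rangle-\langle\gamma,S\rangle}\right]^{1/2},$$ where $|\Phi\rangle$ is a normalized minimizer of the pure-state constrained search at $\rho_*$ (i.e. $\iota^*(|\Phi\rangle\langle\Phi|)=\rho_*$ and $\langle\Phi|W|\Phi\rangle=\mathcal F_p(\rho_* )$), chosen, if there are several minimizers, so that the right-hand side is minimized.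
   Context: A generalized functional theory is a tuple $(V,\mathcal H,\iota,W)$ with $V$ a finite-dimensional real vector space, $\mathcal H$ a finite-dimensional complex Hilbert space, $\iota:V\to i\mathfrak u(\mathcal H)$ a linear map into the Hermitian operators, and $W$ a Hermitian operator on $\mathcal H$. Density operators (ensemble states) $\Gamma$ are regarded as linear functionals on $i\mathfrak u(\mathcal H)$ via $A\mapsto\mathrm{Tr}(\Gamma A)$; the density map is the dual map $\iota^*:(i\mathfrak u(\mathcal H))^*\to V^*$, so $\langle\iota^*(\Gamma),v\rangle=\mathrm{Tr}(\Gamma\iota(v))$. $\mathcal P$ denotes the set of pure states (rank-one projectors). The pure functional is $\mathcal F_p(\rho)=\min\{\langle\Psi|W|\Psi\rangle:\ \|\Psi\|=1,\ \iota^*(|\Psi\rangle\langle\Psi|)=\rho\}$ on $\iota^*(\mathcal P)$. The theory is abelian if $[\iota(v),\iota(v')]=0$ for all $v,v'\in V$. A weight is a $\alpha\in V^*$ such that $\mathcal H_\alpha:=\{\psi:\iota(v)\psi=\langle\alpha,v\rangle\psi\ \forall v\}\neq0$; $\Omega$ is the set of weights, $\mathcal H=\bigoplus_{\omega\in\Omega}\mathcal H_\omega$ orthogonally, and $\Pi_\omega$ is the orthogonal projection onto $\mathcal H_\omega$. In the abelian case $\iota^*(\mathcal P)=\mathrm{conv}(\Omega)$. $\overrightarrow{A}$ denotes the translation space $\{a-b:a,b\in A\}$ of an affine set $A$. *)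

theory Defs
  imports "HOL-Analysis.Analysis"
begin

text \<open>Conventions. V = real^'n, its dual V* is identified with real^'n via the
 pairing (alpha, v) |-> alpha \<bullet> v. The Hilbert space is complex^'m, operators are
 matrices complex^'m^'m acting by *v.\<close>

definition hinner :: "complex^'m \<Rightarrow> complex^'m \<Rightarrow> complex" where
  "hinner x y = (\<Sum>i\<in>UNIV. cnj (x$i) * y$i)"

definition hermitian :: "complex^'m^'m \<Rightarrow> bool" where
  "hermitian A \<longleftrightarrow> (\<forall>i j. A$i$j = cnj (A$j$i))"

definition functional_theory :: "(real^'n \<Rightarrow> complex^'m^'m) \<Rightarrow> complex^'m^'m \<Rightarrow> bool" where
  "functional_theory \<iota> W \<longleftrightarrow> linear \<iota> \<and> (\<forall>v. hermitian (\<iota> v)) \<and> hermitian W"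

definition abelian :: "(real^'n \<Rightarrow> complex^'m^'m) \<Rightarrow> bool" where
  "abelian \<iota> \<longleftrightarrow> (\<forall>v v'. \<iota> v ** \<iota> v' = \<iota> v' ** \<iota> v)"

text \<open>Density map on pure states: iota*(|Psi><Psi|) = rho, i.e. <rho,v> = <Psi|iota(v)|Psi>.\<close>
definition represents :: "(real^'n \<Rightarrow> complex^'m^'m) \<Rightarrow> complex^'m \<Rightarrow> real^'n \<Rightarrow> bool" where
  "represents \<iota> \<Psi> \<rho> \<longleftrightarrow> (\<forall>v. \<rho> \<bullet> v = Re (hinner \<Psi> (\<iota> v *v \<Psi>)))"

definition pure_functional ::
  "(real^'n \<Rightarrow> complex^'m^'m) \<Rightarrow> complex^'m^'m \<Rightarrow> real^'n \<Rightarrow> real" where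
  "pure_functional \<iota> W \<rho> =
     Inf {Re (hinner \<Psi> (W *v \<Psi>)) | \<Psi>. norm \<Psi> = 1 \<and> represents \<iota> \<Psi> \<rho>}"

definition pure_minimizer ::
  "(real^'n \<Rightarrow> complex^'m^'m) \<Rightarrow> complex^'m^'m \<Rightarrow> real^'n \<Rightarrow> complex^'m \<Rightarrow> bool" where
  "pure_minimizer \<iota> W \<rho> \<Phi> \<longleftrightarrow> norm \<Phi> = 1 \<and> represents \<iota> \<Phi> \<rho> \<and>
     Re (hinner \<Phi> (W *v \<Phi>)) = pure_functional \<iota> W \<rho>"

definition weight_space :: "(real^'n \<Rightarrow> complex^'m^'m) \<Rightarrow> real^'n \<Rightarrow> (complex^'m) set" where
  "weight_space \<iota> \<alpha> = {\<psi>. \<forall>v. \<iota> v *v \<psi> = complex_of_real (\<alpha> \<bullet> v) *s \<psi>}"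

definition weights :: "(real^'n \<Rightarrow> complex^'m^'m) \<Rightarrow> (real^'n) set" where
  "weights \<iota> = {\<alpha>. weight_space \<iota> \<alpha> \<noteq> {0}}"

definition weight_proj :: "(real^'n \<Rightarrow> complex^'m^'m) \<Rightarrow> real^'n \<Rightarrow> complex^'m \<Rightarrow> complex^'m" where
  "weight_proj \<iota> \<omega> x = (THE p. p \<in> weight_space \<iota> \<omega> \<and>
      (\<forall>y\<in>weight_space \<iota> \<omega>. hinner y (x - p) = 0))"

definition translation_space :: "'a::real_vector set \<Rightarrow> 'a set" where
  "translation_space A = {a - b | a b. a \<in> A \<and> b \<in> A}"

end

theory Submission
  imports Defs
begin

text \<open>
  Regard the Hilbert space as a real Euclidean space with the orthogonal weight projections
  \<open>Pr \<omega>\<close>; a unit vector \<open>\<Psi>\<close> has density \<open>\<Sum>\<omega>. (norm (Pr \<omega> \<Psi>))\<^sup>2 \<omega>\<close>. Pairing with \<open>S\<close> shows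
  that a state over \<open>\<rho>s + \<epsilon> \<eta>\<close> has a component \<open>x\<close> outside the facet with
  \<open>\<Sum>\<omega>. (norm (Pr \<omega> x))\<^sup>2 (\<omega> \<bullet> S - \<gamma> \<bullet> S) = \<epsilon>\<close>, so \<open>x\<close> has size \<open>sqrt \<epsilon>\<close>, and the leading energy
  change is the cross term \<open>2 (x \<bullet> W \<Phi>)\<close>, whose minimum under this constraint is given by
  Cauchy-Schwarz. By genericity of \<open>\<rho>s\<close> the density constraint inside the facet is repaired by
  rescaling components of \<open>\<Phi>\<close> at a cost of order \<open>\<epsilon>\<close>. This yields the upper bound from a trial
  state and, by compactness of the set of states, the matching lower bound.
\<close>

text \<open>The leading term is of order \<open>sqrt \<epsilon>\<close>, while norm and density must
  be met exactly, so every correction has to cost only order \<open>\<epsilon>\<close>. The outer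
  part \<open>x\<close> and the facet part occupy different weight spaces. Hence \<open>x\<close>
  enters norm and density only quadratically, and the energy alone sees it linearly. The resulting
  defect is of order \<open>\<epsilon>\<close>. Rescaling a component bounded away from zero moves
  the vector in proportion to the change of its squared norm, whereas filling a vanishing component
  would cost a square root. Genericity excludes that cost: the nonzero components of any state over
  \<open>\<rho>s\<close> belong to weights that already span the facet affinely, so every defect can
  be distributed among them. The lower bound cannot be anchored at one chosen minimizer, since good
  states for small \<open>\<epsilon>\<close> may approach any of them. The local estimate therefore
  carries \<open>R\<close> at the state itself, and continuity of \<open>R\<close> transfers it to
  the accumulation point. This is why the largest \<open>R\<close> among all minimizers
  appears.\<close>

section \<open>Linear algebra\<close>

text \<open>A maximizer of the Rayleigh quotient on the unit sphere of \<open>M\<close> is an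
  eigenvector. The version on an invariant subspace is what the joint diagonalization needs.\<close>

lemma selfadjoint_has_eigenvector:
  fixes A :: "'e::euclidean_space \<Rightarrow> 'e"
  assumes lin: "linear A" and sa: "\<And>x y. A x \<bullet> y = x \<bullet> A y"
    and sub: "subspace M" and nz: "M \<noteq> {0}" and inv: "A ` M \<subseteq> M"
  shows "\<exists>c. \<exists>x\<in>M. x \<noteq> 0 \<and> A x = c *\<^sub>R x"
proof -
  interpret A: linear A by (rule lin)
  obtain z where z: "z \<in> M" "z \<noteq> 0" using nz sub subspace_0 by blast
  let ?K = "M \<inter> sphere 0 1"
  have "z /\<^sub>R norm z \<in> ?K" using z sub by (simp add: subspace_scale)
  moreover have "compact ?K"
    by (metis closed_Int_compact closed_subspace compact_sphere sub)
  moreover have "continuous_on ?K (\<lambda>x. x \<bullet> A x)"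
    by (intro continuous_intros linear_continuous_on linear_linear[THEN iffD2] lin)
  ultimately obtain x0 where x0: "x0 \<in> ?K" and mx: "\<And>x. x \<in> ?K \<Longrightarrow> x \<bullet> A x \<le> x0 \<bullet> A x0"
    using continuous_attains_sup[of ?K "\<lambda>x. x \<bullet> A x"] by blast
  define c where "c = x0 \<bullet> A x0"
  have ray: "x \<bullet> A x \<le> c * (x \<bullet> x)" if "x \<in> M" for x
  proof (cases "x = 0")
    case False
    then have "x /\<^sub>R norm x \<in> ?K" using that sub by (simp add: subspace_scale)
    from mx[OF this] have "(x \<bullet> A x) / (norm x)\<^sup>2 \<le> c"
      by (simp add: c_def A.scale power2_eq_square field_simps)
    then show ?thesis using False by (simp add: field_simps power2_norm_eq_inner)
  qed (simp add: A.zero)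
  \<comment> \<open>The residual of the eigenvalue equation. Invariance keeps it in
    \<open>M\<close>, so it is an admissible direction of variation.\<close>
  define d where "d = c *\<^sub>R x0 - A x0"
  have x0M: "x0 \<in> M" and n0: "x0 \<bullet> x0 = 1" using x0 by (auto simp: norm_eq_1)
  have dM: "d \<in> M" unfolding d_def using sub inv x0M by (auto intro!: subspace_diff subspace_scale)
  text \<open>Maximality of the Rayleigh quotient at \<open>x0\<close> along the line through \<open>x0\<close> in direction \<open>d\<close>.\<close>
  have q: "0 \<le> 2 * t * (d \<bullet> d) + t\<^sup>2 * (c * (d \<bullet> d) - d \<bullet> A d)" for t
  proof -
    have "x0 + t *\<^sub>R d \<in> M" using sub x0M dM by (simp add: subspace_add subspace_scale)
    from ray[OF this]
    have "0 \<le> c * ((x0 + t *\<^sub>R d) \<bullet> (x0 + t *\<^sub>R d)) - (x0 + t *\<^sub>R d) \<bullet> A (x0 + t *\<^sub>R d)" by simp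
    also have "\<dots> = c * (x0 \<bullet> x0) - x0 \<bullet> A x0 + 2 * t * (d \<bullet> (c *\<^sub>R x0) - d \<bullet> A x0)
        + t\<^sup>2 * (c * (d \<bullet> d) - d \<bullet> A d)"
      using sa[of x0 d]
      by (simp add: A.add A.scale inner_simps algebra_simps power2_eq_square inner_commute)
    also have "d \<bullet> (c *\<^sub>R x0) - d \<bullet> A x0 = d \<bullet> d" by (simp only: d_def inner_diff_right[symmetric])
    finally show ?thesis by (simp add: n0 c_def)
  qed
  have "d \<bullet> d = 0"
  proof (rule ccontr)
    assume nd: "d \<bullet> d \<noteq> 0"
    then have pd: "d \<bullet> d > 0" by simp
    define k where "k = c * (d \<bullet> d) - d \<bullet> A d"
    define K where "K = \<bar>k\<bar> + 1"
    have K: "K > 0" "k < 2 * K" by (auto simp: K_def)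
    \<comment> \<open>A negative step, small enough for the linear term to dominate:
      \<open>K\<close> exceeds the modulus of the quadratic coefficient \<open>k\<close>.\<close>
    define t where "t = - (d \<bullet> d) / K"
    have "0 \<le> 2 * t * (d \<bullet> d) + t\<^sup>2 * k" using q[of t] by (simp add: k_def)
    also have "\<dots> = (d \<bullet> d)\<^sup>2 / K\<^sup>2 * (k - 2 * K)"
      using K(1) by (simp add: t_def field_simps power2_eq_square)
    also have "\<dots> < 0"
      using pd K by (intro mult_pos_neg divide_pos_pos) auto
    finally show False by simp
  qed
  then have "A x0 = c *\<^sub>R x0" by (simp add: d_def)
  moreover have "x0 \<noteq> 0" using n0 by auto
  ultimately show ?thesis using x0M by blast
qed

text \<open>On a nonzero invariant subspace of least dimension every \<open>A v\<close> is scalar: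
  its eigenspaces there are again invariant because the operators commute, so minimality leaves no
  proper one. The scalars depend linearly on \<open>v\<close>, and the Riesz vector of this
  functional is \<open>\<alpha>\<close>.\<close>

lemma commuting_selfadjoint_joint_eigenvector:
  fixes A :: "'v::euclidean_space \<Rightarrow> 'e::euclidean_space \<Rightarrow> 'e"
  assumes lin: "\<And>v. linear (A v)" and linv: "\<And>x. linear (\<lambda>v. A v x)"
    and sa: "\<And>v x y. A v x \<bullet> y = x \<bullet> A v y"
    and comm: "\<And>v w x. A v (A w x) = A w (A v x)"
    and U: "subspace U" "U \<noteq> {0}" "\<And>v. A v ` U \<subseteq> U"
  shows "\<exists>\<alpha>. \<exists>x\<in>U. x \<noteq> 0 \<and> (\<forall>v. A v x = (\<alpha> \<bullet> v) *\<^sub>R x)"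
proof -
  let ?P = "\<lambda>M. subspace M \<and> M \<noteq> {0} \<and> M \<subseteq> U \<and> (\<forall>v. A v ` M \<subseteq> M)"
  have "?P U" using U by blast
  then obtain M where M: "?P M" and mn: "\<And>N. ?P N \<Longrightarrow> dim M \<le> dim N"
    using ex_has_least_nat[of ?P U dim] by blast
  have scal: "\<exists>c. \<forall>x\<in>M. A v x = c *\<^sub>R x" for v
  proof -
    obtain c x where x: "x \<in> M" "x \<noteq> 0" "A v x = c *\<^sub>R x"
      using selfadjoint_has_eigenvector[of "A v" M] lin sa M by blast
    let ?N = "{y\<in>M. A v y = c *\<^sub>R y}"
    have "subspace ?N"
      using M lin[of v] unfolding subspace_def
      by (auto simp: linear_0 linear_add linear_scale scaleR_add_right)
    moreover have "A w ` ?N \<subseteq> ?N" for w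
      using M comm[of v w] lin[of w] by (auto simp: linear_scale image_subset_iff)
    ultimately have "?P ?N" using x M by blast
    then have "dim M \<le> dim ?N" by (rule mn)
    then have "?N = M"
      using M \<open>subspace ?N\<close> by (intro subspace_dim_equal) auto
    then show ?thesis by blast
  qed
  obtain x where x: "x \<in> M" "x \<noteq> 0" using M subspace_0 by blast
  from scal x obtain c where c: "\<And>v. A v x = c v *\<^sub>R x" by metis
  have "linear c"
  proof
    fix v w
    have "c (v + w) *\<^sub>R x = (c v + c w) *\<^sub>R x"
      using linear_add[OF linv[of x]] by (simp add: c[symmetric] scaleR_add_left)
    then show "c (v + w) = c v + c w" using x by simp
  next
    fix r v
    have "c (r *\<^sub>R v) *\<^sub>R x = (r * c v) *\<^sub>R x"
      using linear_scale[OF linv[of x]] by (simp add: c[symmetric] flip: scaleR_scaleR)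
    then show "c (r *\<^sub>R v) = r *\<^sub>R c v" using x by simp
  qed
  then have "c v = adjoint c 1 \<bullet> v" for v
    using adjoint_works[of c v 1] by (simp add: inner_commute)
  then show ?thesis using c x M by (metis subsetD)
qed

text \<open>Makes the later repair quantitative: a defect of order \<open>\<epsilon>\<close> is
  expanded with coefficients of order \<open>\<epsilon>\<close>. The set \<open>A\<close> may be
  dependent, so coefficients are not unique; expanding the images of the basis vectors once and for
  all selects them linearly in \<open>u\<close>.\<close>

lemma span_coefficients_bounded:
  fixes A :: "'a::euclidean_space set"
  assumes fin: "finite A"
  shows "\<exists>C\<ge>0. \<forall>u\<in>span A. \<exists>q. u = (\<Sum>a\<in>A. q a *\<^sub>R a) \<and> (\<forall>a\<in>A. \<bar>q a\<bar> \<le> C * norm u)"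
proof -
  \<comment> \<open>A linear retraction onto \<open>span A\<close>, obtained as a left inverse of
    the inclusion.\<close>
  obtain g where g: "range g \<subseteq> span A" "linear g" "\<And>v. v \<in> span A \<Longrightarrow> g v = v"
    using linear_exists_left_inverse_on[of "\<lambda>x. x" "span A"] linear_id by (auto simp: id_def)
  have "\<exists>c. g i = (\<Sum>a\<in>A. c a *\<^sub>R a)" for i
    using g(1) span_finite[OF fin] by (metis (mono_tags, lifting) image_iff rangeI subsetD)
  then obtain c where c: "\<And>i. g i = (\<Sum>a\<in>A. c i a *\<^sub>R a)" by metis
  define C where "C = (\<Sum>a\<in>A. \<Sum>i\<in>Basis. \<bar>c i a\<bar>)"
  show ?thesis
  proof (intro exI[of _ C] conjI ballI)
    show "C \<ge> 0" by (simp add: C_def sum_nonneg)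
    fix u assume u: "u \<in> span A"
    have "u = g (\<Sum>i\<in>Basis. (u \<bullet> i) *\<^sub>R i)" using g(3)[OF u] by (simp add: euclidean_representation)
    also have "\<dots> = (\<Sum>i\<in>Basis. (u \<bullet> i) *\<^sub>R g i)" by (simp add: linear_sum[OF g(2)] linear_scale[OF g(2)])
    also have "\<dots> = (\<Sum>i\<in>Basis. \<Sum>a\<in>A. ((u \<bullet> i) * c i a) *\<^sub>R a)" by (subst c) (simp add: scaleR_sum_right)
    also have "\<dots> = (\<Sum>a\<in>A. (\<Sum>i\<in>Basis. (u \<bullet> i) * c i a) *\<^sub>R a)"
      by (subst sum.swap) (simp add: scaleR_sum_left)
    finally have 1: "u = (\<Sum>a\<in>A. (\<Sum>i\<in>Basis. (u \<bullet> i) * c i a) *\<^sub>R a)" .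
    have "\<bar>\<Sum>i\<in>Basis. (u \<bullet> i) * c i a\<bar> \<le> C * norm u" if "a \<in> A" for a
    proof -
      have "\<bar>\<Sum>i\<in>Basis. (u \<bullet> i) * c i a\<bar> \<le> (\<Sum>i\<in>Basis. norm u * \<bar>c i a\<bar>)"
        by (rule order_trans[OF sum_abs]) (auto simp: abs_mult intro!: sum_mono mult_right_mono Basis_le_norm)
      also have "\<dots> = norm u * (\<Sum>i\<in>Basis. \<bar>c i a\<bar>)" by (simp add: sum_distrib_left)
      also have "\<dots> \<le> norm u * C"
        unfolding C_def using that fin
        by (intro mult_left_mono member_le_sum[of a A "\<lambda>a. \<Sum>i\<in>Basis. \<bar>c i a\<bar>"]) (auto simp: sum_nonneg)
      finally show ?thesis by (simp add: mult.commute)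
    qed
    with 1 show "\<exists>q. u = (\<Sum>a\<in>A. q a *\<^sub>R a) \<and> (\<forall>a\<in>A. \<bar>q a\<bar> \<le> C * norm u)"
      by (intro exI[of _ "\<lambda>a. \<Sum>i\<in>Basis. (u \<bullet> i) * c i a"]) blast
  qed
qed

text \<open>Homogenization: the extra coordinate turns affine combinations into linear ones. Below
  it records squared norm, so that norm and density are corrected by one linear system.\<close>

lemma Pair_1_in_span_of_affine_hull:
  fixes T :: "'a::real_vector set"
  assumes "x \<in> affine hull T"
  shows "(1::real, x) \<in> span (Pair 1 ` T)"
proof -
  have "affine {x. (1::real, x) \<in> span (Pair 1 ` T)}"
    unfolding affine_def
  proof (intro ballI allI impI)
    fix x y and u v :: real
    assume "x \<in> {x. (1::real, x) \<in> span (Pair 1 ` T)}" "y \<in> {x. (1::real, x) \<in> span (Pair 1 ` T)}" "u + v = 1"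
    then have "u *\<^sub>R (1::real, x) + v *\<^sub>R (1::real, y) \<in> span (Pair 1 ` T)"
      by (intro span_add span_scale) auto
    with \<open>u + v = 1\<close> show "u *\<^sub>R x + v *\<^sub>R y \<in> {x. (1::real, x) \<in> span (Pair 1 ` T)}" by simp
  qed
  then have "affine hull T \<subseteq> {x. (1::real, x) \<in> span (Pair 1 ` T)}"
    by (intro hull_minimal) (auto intro: span_base)
  with assms show ?thesis by blast
qed

section \<open>Orthogonal resolutions of the identity indexed by weights\<close>

text \<open>Isolates what the analysis uses of the theory. A real space suffices because energies
  and densities involve only real parts of inner products.\<close>

locale weight_resolution =
  fixes \<Omega> :: "'v::euclidean_space set" and Pr :: "'v \<Rightarrow> 'e::euclidean_space \<Rightarrow> 'e" and W :: "'e \<Rightarrow> 'e"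
  assumes finite_weights: "finite \<Omega>"
    and Pr_linear: "\<And>\<omega>. \<omega> \<in> \<Omega> \<Longrightarrow> linear (Pr \<omega>)"
    and Pr_selfadjoint: "\<And>\<omega> x y. \<omega> \<in> \<Omega> \<Longrightarrow> Pr \<omega> x \<bullet> y = x \<bullet> Pr \<omega> y"
    and Pr_idem: "\<And>\<omega> x. \<omega> \<in> \<Omega> \<Longrightarrow> Pr \<omega> (Pr \<omega> x) = Pr \<omega> x"
    and Pr_orth: "\<And>\<omega> \<omega>' x. \<omega> \<in> \<Omega> \<Longrightarrow> \<omega>' \<in> \<Omega> \<Longrightarrow> \<omega> \<noteq> \<omega>' \<Longrightarrow> Pr \<omega> (Pr \<omega>' x) = 0"
    and sum_Pr: "\<And>x. (\<Sum>\<omega>\<in>\<Omega>. Pr \<omega> x) = x"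
    and Pr_nontrivial: "\<And>\<omega>. \<omega> \<in> \<Omega> \<Longrightarrow> \<exists>x. Pr \<omega> x \<noteq> 0"
    and W_linear: "linear W"
    and W_selfadjoint: "\<And>x y. W x \<bullet> y = x \<bullet> W y"
begin

definition dens :: "'e \<Rightarrow> 'v" where
  "dens x = (\<Sum>\<omega>\<in>\<Omega>. (norm (Pr \<omega> x))\<^sup>2 *\<^sub>R \<omega>)"

definition energy :: "'e \<Rightarrow> real" where
  "energy x = x \<bullet> W x"

definition states :: "'v \<Rightarrow> 'e set" where
  "states \<rho> = {x. norm x = 1 \<and> dens x = \<rho>}"

definition Fp :: "'v \<Rightarrow> real" where
  "Fp \<rho> = Inf (energy ` states \<rho>)"

lemmas Pr_add = linear_add[OF Pr_linear]
  and Pr_diff = linear_diff[OF Pr_linear]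
  and Pr_scale = linear_scale[OF Pr_linear]
  and Pr_sum = linear_sum[OF Pr_linear]

text \<open>Reads off the components of vectors built by rescaling or discarding components of a
  given one, the form of most constructions below.\<close>

lemma Pr_sum_scaleR:
  assumes A: "A \<subseteq> \<Omega>" and \<omega>: "\<omega> \<in> \<Omega>"
  shows "Pr \<omega> (\<Sum>\<omega>'\<in>A. s \<omega>' *\<^sub>R Pr \<omega>' x) = (if \<omega> \<in> A then s \<omega> *\<^sub>R Pr \<omega> x else 0)"
proof -
  have "Pr \<omega> (\<Sum>\<omega>'\<in>A. s \<omega>' *\<^sub>R Pr \<omega>' x) = (\<Sum>\<omega>'\<in>A. s \<omega>' *\<^sub>R Pr \<omega> (Pr \<omega>' x))"
    using \<omega> by (simp add: Pr_sum Pr_scale)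
  also have "\<dots> = (\<Sum>\<omega>'\<in>A. if \<omega>' = \<omega> then s \<omega> *\<^sub>R Pr \<omega> x else 0)"
    using A \<omega> by (intro sum.cong) (auto simp: Pr_idem Pr_orth subset_iff)
  also have "\<dots> = (if \<omega> \<in> A then s \<omega> *\<^sub>R Pr \<omega> x else 0)"
    using finite_subset[OF A finite_weights] by (auto simp: sum.delta)
  finally show ?thesis .
qed

section \<open>Parseval identities for the weight decomposition\<close>

lemma inner_Pr: "\<omega> \<in> \<Omega> \<Longrightarrow> x \<bullet> Pr \<omega> y = Pr \<omega> x \<bullet> Pr \<omega> y"
  using Pr_selfadjoint[of \<omega> x "Pr \<omega> y"] by (simp add: Pr_idem)

lemma inner_eq_sum_Pr: "x \<bullet> y = (\<Sum>\<omega>\<in>\<Omega>. Pr \<omega> x \<bullet> Pr \<omega> y)"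
proof -
  have "x \<bullet> y = (\<Sum>\<omega>\<in>\<Omega>. x \<bullet> Pr \<omega> y)" by (metis inner_sum_right sum_Pr)
  also have "\<dots> = (\<Sum>\<omega>\<in>\<Omega>. Pr \<omega> x \<bullet> Pr \<omega> y)" by (intro sum.cong refl inner_Pr)
  finally show ?thesis .
qed

lemma norm_power2_eq_sum_Pr: "(norm x)\<^sup>2 = (\<Sum>\<omega>\<in>\<Omega>. (norm (Pr \<omega> x))\<^sup>2)"
  by (simp add: power2_norm_eq_inner inner_eq_sum_Pr[of x x])

lemma norm_Pr_le: "\<omega> \<in> \<Omega> \<Longrightarrow> norm (Pr \<omega> x) \<le> norm x"
proof -
  assume \<omega>: "\<omega> \<in> \<Omega>"
  have "(norm (Pr \<omega> x))\<^sup>2 \<le> (norm x)\<^sup>2"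
    unfolding norm_power2_eq_sum_Pr[of x] using \<omega> finite_weights
    by (intro member_le_sum) auto
  then show ?thesis by (rule power2_le_imp_le) simp
qed

section \<open>Continuity, compactness and attainment of the constrained minimum\<close>

lemma continuous_Pr: "\<omega> \<in> \<Omega> \<Longrightarrow> continuous_on UNIV (Pr \<omega>)"
  using Pr_linear by (simp add: linear_continuous_on linear_linear)

lemma continuous_W: "continuous_on UNIV W"
  using W_linear by (simp add: linear_continuous_on linear_linear)

lemma continuous_energy: "continuous_on A energy"
  unfolding energy_def
  by (intro continuous_intros continuous_on_subset[OF continuous_W]) auto

lemma continuous_dens: "continuous_on A dens"
  unfolding dens_def
  by (intro continuous_intros continuous_on_subset[OF continuous_Pr]) auto

lemma compact_states: "compact (states \<rho>)"
proof -
  have "states \<rho> = sphere 0 1 \<inter> dens -` {\<rho>}" by (auto simp: states_def)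
  moreover have "closed (dens -` {\<rho>})"
    using continuous_dens[of UNIV] by (intro continuous_closed_vimage) (auto simp: continuous_on_eq_continuous_at)
  ultimately show ?thesis by (simp add: compact_Int_closed)
qed

text \<open>Superpose one unit vector per weight, with the square roots of the convex coefficients
  as amplitudes.\<close>

lemma states_nonempty:
  assumes "\<rho> \<in> convex hull \<Omega>"
  shows "states \<rho> \<noteq> {}"
proof -
  obtain u where u: "\<And>\<omega>. \<omega> \<in> \<Omega> \<Longrightarrow> 0 \<le> u \<omega>" "sum u \<Omega> = 1" "(\<Sum>\<omega>\<in>\<Omega>. u \<omega> *\<^sub>R \<omega>) = \<rho>"
    using assms convex_hull_finite[OF finite_weights] by auto
  have "\<exists>y. norm y = 1 \<and> Pr \<omega> y = y" if \<omega>: "\<omega> \<in> \<Omega>" for \<omega>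
  proof -
    obtain x where "Pr \<omega> x \<noteq> 0" using Pr_nontrivial \<omega> by blast
    then show ?thesis using \<omega>
      by (intro exI[of _ "Pr \<omega> x /\<^sub>R norm (Pr \<omega> x)"]) (simp add: Pr_scale Pr_idem)
  qed
  then obtain e where e: "\<And>\<omega>. \<omega> \<in> \<Omega> \<Longrightarrow> norm (e \<omega>) = 1 \<and> Pr \<omega> (e \<omega>) = e \<omega>" by metis
  define x where "x = (\<Sum>\<omega>\<in>\<Omega>. sqrt (u \<omega>) *\<^sub>R e \<omega>)"
  have Px: "Pr \<omega> x = sqrt (u \<omega>) *\<^sub>R e \<omega>" if \<omega>: "\<omega> \<in> \<Omega>" for \<omega>
  proof -
    have "Pr \<omega> x = (\<Sum>\<omega>'\<in>\<Omega>. sqrt (u \<omega>') *\<^sub>R Pr \<omega> (Pr \<omega>' (e \<omega>')))"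
      unfolding x_def using \<omega> e by (simp add: Pr_sum Pr_scale)
    also have "\<dots> = (\<Sum>\<omega>'\<in>\<Omega>. if \<omega>' = \<omega> then sqrt (u \<omega>) *\<^sub>R e \<omega> else 0)"
      using \<omega> e Pr_orth by (intro sum.cong refl) (metis (full_types) scaleR_zero_right)
    finally show ?thesis using \<omega> finite_weights by (simp add: sum.delta)
  qed
  have nx: "(norm (Pr \<omega> x))\<^sup>2 = u \<omega>" if "\<omega> \<in> \<Omega>" for \<omega>
    using Px[OF that] e[OF that] u(1)[OF that] by simp
  have "(norm x)\<^sup>2 = 1" using nx u by (simp add: norm_power2_eq_sum_Pr[of x])
  moreover have "dens x = \<rho>" using nx u by (simp add: dens_def)
  ultimately have "x \<in> states \<rho>"
    by (simp add: states_def abs_square_eq_1)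
  then show ?thesis by blast
qed

lemma bdd_below_energy: "bdd_below (energy ` states \<rho>)"
  by (intro bounded_imp_bdd_below compact_imp_bounded compact_continuous_image
      continuous_energy compact_states)

lemma Fp_le: "x \<in> states \<rho> \<Longrightarrow> Fp \<rho> \<le> energy x"
  unfolding Fp_def by (intro cInf_lower bdd_below_energy) auto

lemma minimizer_exists:
  assumes "states \<rho> \<noteq> {}"
  obtains x where "x \<in> states \<rho>" "energy x = Fp \<rho>"
proof -
  obtain x where x: "x \<in> states \<rho>" "\<And>y. y \<in> states \<rho> \<Longrightarrow> energy x \<le> energy y"
    using continuous_attains_inf[OF compact_states assms continuous_energy] by blast
  then have "energy x \<le> Fp \<rho>"
    unfolding Fp_def using assms by (intro cInf_greatest) auto
  with Fp_le[OF x(1)] x(1) that show thesis by force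
qed

text \<open>Self-adjointness merges the two mixed terms; the linear one is the source of the
  \<open>sqrt \<epsilon>\<close> behaviour.\<close>

lemma energy_add: "energy (x + h) = energy x + 2 * (h \<bullet> W x) + energy h"
  using W_selfadjoint[of x h]
  by (simp add: energy_def linear_add[OF W_linear] inner_simps inner_commute)

lemma W_bound: obtains B where "B \<ge> 0" "\<And>x. norm (W x) \<le> B * norm x"
proof -
  obtain B where "B > 0" "\<And>x. norm (W x) \<le> B * norm x"
    using linear_bounded_pos[OF W_linear] by blast
  then show thesis using that[of B] by simp
qed

lemma dens_inner: "dens x \<bullet> v = (\<Sum>\<omega>\<in>\<Omega>. (norm (Pr \<omega> x))\<^sup>2 * (\<omega> \<bullet> v))"
  by (simp add: dens_def inner_sum_left)

lemma states_inner_diff: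
  assumes "x \<in> states \<rho>"
  shows "(\<Sum>\<omega>\<in>\<Omega>. (norm (Pr \<omega> x))\<^sup>2 * (\<omega> \<bullet> v - c)) = \<rho> \<bullet> v - c"
proof -
  have "(\<Sum>\<omega>\<in>\<Omega>. (norm (Pr \<omega> x))\<^sup>2 * (\<omega> \<bullet> v - c)) = dens x \<bullet> v - c * (norm x)\<^sup>2"
    by (simp add: dens_inner norm_power2_eq_sum_Pr[of x] sum_distrib_left sum_subtractf algebra_simps)
  then show ?thesis using assms by (simp add: states_def)
qed

text \<open>\<open>\<Psi>'\<close> arises by rescaling the components of \<open>\<Psi>\<close> in the support of \<open>\<Phi>\<close>; since the squared
  norms enter the constraint linearly, no implicit function theorem is needed.\<close>

lemma adjust_state:
  fixes \<Phi> :: 'e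
  defines "T \<equiv> {\<omega>\<in>\<Omega>. Pr \<omega> \<Phi> \<noteq> 0}"
  shows "\<exists>\<delta>>0. \<exists>C\<ge>0. \<forall>\<Psi> m z. norm (\<Psi> - \<Phi>) < \<delta> \<longrightarrow> norm (m::real, z) < \<delta> \<longrightarrow>
      (m, z) \<in> span (Pair 1 ` T) \<longrightarrow>
      (\<exists>\<Psi>'. norm (\<Psi>' - \<Psi>) \<le> C * norm (m, z) \<and> (norm \<Psi>')\<^sup>2 = (norm \<Psi>)\<^sup>2 + m \<and>
            dens \<Psi>' = dens \<Psi> + z)"
proof -
  have T: "T \<subseteq> \<Omega>" "finite T" using finite_weights by (auto simp: T_def)
  obtain C0 where C0: "C0 \<ge> 0" and q0: "\<And>u. u \<in> span (Pair (1::real) ` T) \<Longrightarrow>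
      \<exists>q. u = (\<Sum>a\<in>Pair 1 ` T. q a *\<^sub>R a) \<and> (\<forall>a\<in>Pair 1 ` T. \<bar>q a\<bar> \<le> C0 * norm u)"
    using span_coefficients_bounded[of "Pair (1::real) ` T"] T by blast
  have "\<exists>\<mu>>0. \<forall>\<omega>\<in>T. \<mu> \<le> norm (Pr \<omega> \<Phi>)"
  proof (cases "T = {}")
    case False
    then show ?thesis using T
      by (intro exI[of _ "Min ((\<lambda>\<omega>. norm (Pr \<omega> \<Phi>)) ` T)"]) (auto simp: T_def)
  qed (auto intro: exI[of _ 1])
  then obtain \<mu> where \<mu>: "\<mu> > 0" "\<And>\<omega>. \<omega> \<in> T \<Longrightarrow> \<mu> \<le> norm (Pr \<omega> \<Phi>)" by blast
  \<comment> \<open>The first bound keeps the components of \<open>\<Psi>\<close> on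
    \<open>T\<close> at least \<open>\<mu> / 2\<close>; the second keeps each coefficient below
    \<open>(\<mu> / 2)^2\<close>, so the radicands in \<open>s\<close> are nonnegative. The summand
    1 in \<open>C0 + 1\<close> guards against \<open>C0 = 0\<close>.\<close>
  define \<delta> where "\<delta> = min (\<mu> / 2) (\<mu>\<^sup>2 / (4 * (C0 + 1)))"
  \<comment> \<open>Each of the \<open>card T\<close> rescaled components moves by at most its
    coefficient divided by its norm, which is at least \<open>\<mu> / 2\<close>.\<close>
  define C where "C = real (card T) * (C0 * (2 / \<mu>))"
  have \<delta>: "\<delta> > 0" "\<delta> \<le> \<mu> / 2" "C0 * \<delta> \<le> (\<mu> / 2)\<^sup>2"
  proof -
    show "\<delta> > 0" using \<mu> C0 by (auto simp: \<delta>_def)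
    show "\<delta> \<le> \<mu> / 2" unfolding \<delta>_def by (rule min.cobounded1)
    have "C0 * \<delta> \<le> (C0 + 1) * (\<mu>\<^sup>2 / (4 * (C0 + 1)))"
      using C0 \<open>\<delta> > 0\<close> by (intro mult_mono) (auto simp: \<delta>_def)
    also have "\<dots> = (\<mu> / 2)\<^sup>2" using C0 by (simp add: power_divide divide_simps)
    finally show "C0 * \<delta> \<le> (\<mu> / 2)\<^sup>2" .
  qed
  show ?thesis
  proof (rule exI[of _ \<delta>], rule conjI, rule \<delta>(1), rule exI[of _ C], intro conjI allI impI)
    show "C \<ge> 0" using C0 \<mu>(1) by (simp add: C_def)
    fix \<Psi> m z
    assume near: "norm (\<Psi> - \<Phi>) < \<delta>" and small: "norm (m::real, z) < \<delta>"
      and sp: "(m, z) \<in> span (Pair 1 ` T)"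
    obtain q' where q': "(m, z) = (\<Sum>a\<in>Pair 1 ` T. q' a *\<^sub>R a)"
      "\<And>a. a \<in> Pair 1 ` T \<Longrightarrow> \<bar>q' a\<bar> \<le> C0 * norm (m, z)" using q0[OF sp] by blast
    define q where "q \<omega> = q' (1, \<omega>)" for \<omega>
    have qb: "\<bar>q \<omega>\<bar> \<le> C0 * norm (m, z)" if "\<omega> \<in> T" for \<omega> using q'(2) that by (auto simp: q_def)
    have "(m, z) = (\<Sum>\<omega>\<in>T. q \<omega> *\<^sub>R (1, \<omega>))"
      unfolding q'(1) q_def by (subst sum.reindex) (auto simp: inj_on_def)
    then have mq: "m = (\<Sum>\<omega>\<in>T. q \<omega>)" and zq: "z = (\<Sum>\<omega>\<in>T. q \<omega> *\<^sub>R \<omega>)"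
      by (auto simp: prod_eq_iff fst_sum snd_sum)
    have big: "\<mu> / 2 \<le> norm (Pr \<omega> \<Psi>)" if "\<omega> \<in> T" for \<omega>
    proof -
      have w: "\<omega> \<in> \<Omega>" using that T by blast
      have "norm (Pr \<omega> \<Phi>) \<le> norm (Pr \<omega> \<Psi>) + norm (Pr \<omega> (\<Psi> - \<Phi>))"
        unfolding Pr_diff[OF w] by norm
      also have "norm (Pr \<omega> (\<Psi> - \<Phi>)) \<le> \<mu> / 2" using norm_Pr_le[OF w, of "\<Psi> - \<Phi>"] near \<delta> by linarith
      finally show ?thesis using \<mu>(2)[OF that] by linarith
    qed
    \<comment> \<open>The factor that raises the squared norm of the component by exactly
      \<open>q \<omega>\<close>; components outside \<open>T\<close> stay untouched.\<close>
    define s where "s \<omega> = (if \<omega> \<in> T then sqrt (1 + q \<omega> / (norm (Pr \<omega> \<Psi>))\<^sup>2) else 1)" for \<omega>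
    define \<Psi>' where "\<Psi>' = (\<Sum>\<omega>\<in>\<Omega>. s \<omega> *\<^sub>R Pr \<omega> \<Psi>)"
    have P': "Pr \<omega> \<Psi>' = s \<omega> *\<^sub>R Pr \<omega> \<Psi>" if "\<omega> \<in> \<Omega>" for \<omega>
      using that by (simp add: \<Psi>'_def Pr_sum_scaleR)
    have pos: "0 \<le> 1 + q \<omega> / (norm (Pr \<omega> \<Psi>))\<^sup>2" "norm (Pr \<omega> \<Psi>) > 0" if "\<omega> \<in> T" for \<omega>
    proof -
      show p: "norm (Pr \<omega> \<Psi>) > 0" using big[OF that] \<mu>(1) by linarith
      have "C0 * norm (m, z) \<le> C0 * \<delta>" using small C0 by (intro mult_left_mono) auto
      then have "\<bar>q \<omega>\<bar> \<le> (\<mu> / 2)\<^sup>2" using qb[OF that] \<delta> by linarith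
      also have "\<dots> \<le> (norm (Pr \<omega> \<Psi>))\<^sup>2" using big[OF that] \<mu> by (intro power_mono) auto
      finally have "- (norm (Pr \<omega> \<Psi>))\<^sup>2 \<le> q \<omega>" by linarith
      then show "0 \<le> 1 + q \<omega> / (norm (Pr \<omega> \<Psi>))\<^sup>2" using p by (simp add: field_simps)
    qed
    have n': "(norm (Pr \<omega> \<Psi>'))\<^sup>2 = (norm (Pr \<omega> \<Psi>))\<^sup>2 + (if \<omega> \<in> T then q \<omega> else 0)" if "\<omega> \<in> \<Omega>" for \<omega>
      using P'[OF that] pos[of \<omega>] by (auto simp: s_def power_mult_distrib field_simps)
    have "(norm \<Psi>')\<^sup>2 = (norm \<Psi>)\<^sup>2 + m"
      using n' T finite_weights
      by (simp add: norm_power2_eq_sum_Pr[of \<Psi>] norm_power2_eq_sum_Pr[of \<Psi>'] sum.distrib mq sum.inter_restrict[symmetric] Int_absorb1)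
    moreover have "dens \<Psi>' = dens \<Psi> + z"
    proof -
      have "dens \<Psi>' = dens \<Psi> + (\<Sum>\<omega>\<in>\<Omega>. if \<omega> \<in> T then q \<omega> *\<^sub>R \<omega> else 0)"
        unfolding dens_def sum.distrib[symmetric] using n'
        by (intro sum.cong) (auto simp: scaleR_add_left)
      also have "(\<Sum>\<omega>\<in>\<Omega>. if \<omega> \<in> T then q \<omega> *\<^sub>R \<omega> else 0) = z"
        using T finite_weights by (simp add: zq sum.inter_restrict[symmetric] Int_absorb1)
      finally show ?thesis .
    qed
    moreover have "norm (\<Psi>' - \<Psi>) \<le> C * norm (m, z)"
    proof -
      have "\<Psi>' - \<Psi> = (\<Sum>\<omega>\<in>\<Omega>. s \<omega> *\<^sub>R Pr \<omega> \<Psi> - Pr \<omega> \<Psi>)"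
        by (simp add: \<Psi>'_def sum_subtractf sum_Pr)
      also have "\<dots> = (\<Sum>\<omega>\<in>T. s \<omega> *\<^sub>R Pr \<omega> \<Psi> - Pr \<omega> \<Psi>)"
        using T finite_weights by (intro sum.mono_neutral_right) (auto simp: s_def)
      also have "norm \<dots> \<le> (\<Sum>\<omega>\<in>T. C0 * norm (m, z) * (2 / \<mu>))"
      proof (rule sum_norm_le)
        fix \<omega> assume \<omega>: "\<omega> \<in> T"
        let ?n = "norm (Pr \<omega> \<Psi>)"
        define a where "a = q \<omega> / ?n\<^sup>2"
        have a1: "0 \<le> 1 + a" using pos[OF \<omega>] by (simp add: a_def)
        \<comment> \<open>The factor \<open>sqrt (1 + a) + 1\<close> is at least 1, and its product
          with \<open>sqrt (1 + a) - 1\<close> is \<open>a\<close>.\<close>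
        have "\<bar>sqrt (1 + a) - 1\<bar> \<le> \<bar>sqrt (1 + a) - 1\<bar> * (sqrt (1 + a) + 1)"
          using a1 by (intro mult_le_cancel_left1[THEN iffD2]) auto
        also have "\<dots> = \<bar>(sqrt (1 + a) - 1) * (sqrt (1 + a) + 1)\<bar>" using a1 by (simp add: abs_mult)
        also have "(sqrt (1 + a) - 1) * (sqrt (1 + a) + 1) = a" using a1 by (simp add: algebra_simps)
        finally have "\<bar>s \<omega> - 1\<bar> \<le> \<bar>a\<bar>" using \<omega> by (simp add: s_def a_def)
        then have "norm ((s \<omega> - 1) *\<^sub>R Pr \<omega> \<Psi>) \<le> \<bar>a\<bar> * ?n"
          by (simp add: mult_right_mono)
        also have "\<dots> = \<bar>q \<omega>\<bar> * (1 / ?n)" using pos[OF \<omega>] by (simp add: a_def power2_eq_square)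
        also have "\<dots> \<le> C0 * norm (m, z) * (2 / \<mu>)"
        proof (intro mult_mono qb[OF \<omega>])
          show "1 / ?n \<le> 2 / \<mu>" using big[OF \<omega>] pos[OF \<omega>] \<mu> by (simp add: field_simps)
        qed (use C0 in auto)
        finally show "norm (s \<omega> *\<^sub>R Pr \<omega> \<Psi> - Pr \<omega> \<Psi>) \<le> C0 * norm (m, z) * (2 / \<mu>)"
          by (simp add: scaleR_diff_left)
      qed
      also have "\<dots> = C * norm (m, z)" by (simp add: C_def)
      finally show ?thesis .
    qed
    ultimately show "\<exists>\<Psi>'. norm (\<Psi>' - \<Psi>) \<le> C * norm (m, z) \<and> (norm \<Psi>')\<^sup>2 = (norm \<Psi>)\<^sup>2 + m \<and>
            dens \<Psi>' = dens \<Psi> + z" by blast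
  qed
qed

end

section \<open>Geometry near the facet\<close>

locale facet_resolution = weight_resolution \<Omega> Pr W
  for \<Omega> :: "'v::euclidean_space set" and Pr :: "'v \<Rightarrow> 'e::euclidean_space \<Rightarrow> 'e" and W :: "'e \<Rightarrow> 'e" +
  fixes F :: "'v set" and \<rho>s \<eta> S \<gamma> :: 'v
  assumes facet: "F facet_of convex hull \<Omega>"
    and rho_in: "\<rho>s \<in> F"
    and rho_generic: "\<And>T. T \<subseteq> \<Omega> \<inter> F \<Longrightarrow> card T \<le> nat (aff_dim F) \<Longrightarrow> \<rho>s \<notin> convex hull T"
    and eta_dir: "\<eta> \<in> translation_space (affine hull \<Omega>)"
    and eta_inward: "\<forall>\<^sub>F \<epsilon> in at_right 0. \<rho>s + \<epsilon> *\<^sub>R \<eta> \<in> convex hull \<Omega>"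
    and S_perp: "\<And>\<alpha>. \<alpha> \<in> translation_space (affine hull F) \<Longrightarrow> \<alpha> \<bullet> S = 0"
    and S_eta: "\<eta> \<bullet> S = 1"
    and gamma: "\<gamma> \<in> affine hull F"
begin

text \<open>Height above the hyperplane of the facet, in the unit in which \<open>\<eta>\<close> has
  height 1; any \<open>\<gamma>\<close> in the affine hull of \<open>F\<close> gives the same
  value.\<close>

definition d :: "'v \<Rightarrow> real" where "d \<omega> = \<omega> \<bullet> S - \<gamma> \<bullet> S"

definition gap :: "'e \<Rightarrow> real" where "gap x = (\<Sum>\<omega>\<in>\<Omega>. (norm (Pr \<omega> x))\<^sup>2 * d \<omega>)"

text \<open>The norm of the outer part of \<open>W x\<close> dual to the norm
  \<open>sqrt (gap z)\<close> on outer vectors \<open>z\<close>: it bounds the cross term and is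
  attained.\<close>

definition R :: "'e \<Rightarrow> real" where
  "R x = sqrt (\<Sum>\<omega>\<in>\<Omega> - F. (norm (Pr \<omega> (W x)))\<^sup>2 / d \<omega>)"

definition D :: "'v set" where "D = (\<lambda>x. x - \<gamma>) ` (affine hull \<Omega>)"

section \<open>Heights of the weights relative to the facet\<close>

lemma F_face: "F face_of convex hull \<Omega>" and F_subset: "F \<subseteq> convex hull \<Omega>"
  using facet facet_of_imp_face_of facet_of_imp_subset by blast+

lemma affine_hull_F_subset: "affine hull F \<subseteq> affine hull \<Omega>"
  using F_subset convex_hull_subset_affine_hull by (metis affine_affine_hull hull_minimal subset_trans)

lemma S_const: "x \<in> affine hull F \<Longrightarrow> x \<bullet> S = \<gamma> \<bullet> S"
  using S_perp[of "x - \<gamma>"] gamma by (auto simp: translation_space_def inner_diff_left)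

lemma subspace_D: "subspace D"
  unfolding D_def using gamma affine_hull_F_subset
  by (intro affine_diffs_subspace_subtract affine_affine_hull) auto

lemma eta_in_D: "\<eta> \<in> D"
proof -
  obtain a b where ab: "a \<in> affine hull \<Omega>" "b \<in> affine hull \<Omega>" "\<eta> = a - b"
    using eta_dir by (auto simp: translation_space_def)
  then have "(a - \<gamma>) - (b - \<gamma>) \<in> D"
    by (intro subspace_diff[OF subspace_D, of "a - \<gamma>" "b - \<gamma>"]) (auto simp: D_def)
  then show ?thesis using ab by simp
qed

text \<open>A dimension count. The level set contains the affine hull of \<open>F\<close>, which has
  codimension one, and it is a proper subspace of the affine hull of \<open>\<Omega>\<close> because
  \<open>\<eta>\<close> leaves it; so the two coincide.\<close>

lemma level_set_subset:
  assumes x: "x \<in> affine hull \<Omega>" and eq: "x \<bullet> S = \<gamma> \<bullet> S"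
  shows "x \<in> affine hull F"
proof -
  define G where "G = affine hull \<Omega> \<inter> {x. S \<bullet> x = \<gamma> \<bullet> S}"
  have aG: "affine G" unfolding G_def by (intro affine_Int affine_hyperplane affine_affine_hull)
  have FG: "affine hull F \<subseteq> G"
    using affine_hull_F_subset S_const by (auto simp: G_def inner_commute)
  obtain y where y: "y \<in> affine hull \<Omega>" "\<eta> = y - \<gamma>" using eta_in_D by (auto simp: D_def)
  have "y \<notin> G" using S_eta y by (simp add: G_def inner_diff_right inner_commute[of _ S])
  with y have "G \<subset> affine hull \<Omega>" by (auto simp: G_def)
  then have "aff_dim G < aff_dim \<Omega>"
    using aG by (intro aff_dim_psubset) (simp add: affine_hull_eq[THEN iffD2])
  moreover have "aff_dim F = aff_dim \<Omega> - 1" using facet by (simp add: facet_of_def aff_dim_convex_hull)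
  moreover have "aff_dim F \<le> aff_dim G" using FG by (metis aff_dim_affine_hull aff_dim_subset)
  ultimately have "aff_dim (affine hull F) = aff_dim G" by simp
  then have "affine hull F = G"
    using FG aG gamma by (intro affine_dim_equal) auto
  then show ?thesis using x eq by (simp add: G_def inner_commute)
qed

lemma F_eq: "F = affine hull F \<inter> convex hull \<Omega>"
  by (rule face_of_imp_eq_affine_Int[OF convex_convex_hull F_face])

lemma rho_S: "\<rho>s \<bullet> S = \<gamma> \<bullet> S"
  using S_const rho_in hull_inc by metis

text \<open>Orthogonality to the facet leaves the side of the hyperplane undecided; inwardness of
  \<open>\<eta>\<close> supplies a point of the polytope at positive height, from which all signs
  follow.\<close>

lemma inward_point: obtains y where "y \<in> convex hull \<Omega>" "y \<bullet> S > \<gamma> \<bullet> S"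
proof -
  from eta_inward obtain b where b: "b > 0" "\<And>\<epsilon>. 0 < \<epsilon> \<Longrightarrow> \<epsilon> < b \<Longrightarrow> \<rho>s + \<epsilon> *\<^sub>R \<eta> \<in> convex hull \<Omega>"
    unfolding eventually_at_right_field by auto
  then have "\<rho>s + (b / 2) *\<^sub>R \<eta> \<in> convex hull \<Omega>" by simp
  moreover have "(\<rho>s + (b / 2) *\<^sub>R \<eta>) \<bullet> S > \<gamma> \<bullet> S"
    using b S_eta rho_S by (simp add: inner_add_left)
  ultimately show thesis by (rule that)
qed

text \<open>A weight at negative height, joined to a point at positive height, would have a point of
  the facet inside the segment, and the face property would put the weight itself into
  \<open>F\<close>. Height zero is excluded by the level set.\<close>

lemma d_pos: assumes \<omega>: "\<omega> \<in> \<Omega>" "\<omega> \<notin> F" shows "d \<omega> > 0"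
proof (rule ccontr)
  assume neg: "\<not> d \<omega> > 0"
  have inK: "\<omega> \<in> convex hull \<Omega>" using \<omega> by (simp add: hull_inc)
  have "d \<omega> \<noteq> 0"
    using level_set_subset[of \<omega>] F_eq inK \<omega> hull_inc[of \<omega> \<Omega> affine] by (auto simp: d_def)
  with neg have dn: "d \<omega> < 0" by simp
  obtain y where y: "y \<in> convex hull \<Omega>" "y \<bullet> S > \<gamma> \<bullet> S" by (rule inward_point)
  \<comment> \<open>The parameter at which the height, affine along the segment, vanishes.\<close>
  define t where "t = - d \<omega> / (d y - d \<omega>)"
  have dy: "d y > 0" using y by (simp add: d_def)
  have t: "0 < t" "t < 1" using dn dy by (auto simp: t_def field_simps)
  define x where "x = (1 - t) *\<^sub>R \<omega> + t *\<^sub>R y"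
  have xK: "x \<in> convex hull \<Omega>"
    unfolding x_def using t inK y by (intro convexD[OF convex_convex_hull]) auto
  have "x \<bullet> S - \<gamma> \<bullet> S = (1 - t) * d \<omega> + t * d y"
    by (simp add: x_def d_def inner_add_left algebra_simps)
  also have "\<dots> = d \<omega> + t * (d y - d \<omega>)" by (simp add: algebra_simps)
  also have "\<dots> = 0" using dn dy by (simp add: t_def)
  finally have "x \<in> F"
    using level_set_subset[of x] F_eq xK convex_hull_subset_affine_hull by (metis IntI eq_iff_diff_eq_0 subsetD)
  moreover have "x \<in> open_segment \<omega> y"
    using t dn dy by (auto simp: in_segment x_def intro!: exI[of _ t])
  ultimately have "\<omega> \<in> F"
    using F_face inK y unfolding face_of_def by blast
  with \<omega> show False by blast
qed

lemma d_zero: "\<omega> \<in> F \<Longrightarrow> d \<omega> = 0"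
  using S_const hull_inc by (metis d_def eq_iff_diff_eq_0)

lemma d_nonneg: "\<omega> \<in> \<Omega> \<Longrightarrow> d \<omega> \<ge> 0"
  using d_pos d_zero by (metis less_eq_real_def)

lemma outer_weight_exists: "\<Omega> - F \<noteq> {}"
proof
  assume "\<Omega> - F = {}"
  then have "\<Omega> \<subseteq> affine hull F" by (auto intro: hull_inc)
  then have "convex hull \<Omega> \<subseteq> affine hull F"
    by (intro hull_minimal) (auto simp: affine_imp_convex)
  then show False using inward_point S_const by (metis less_irrefl subsetD)
qed

text \<open>The mean height of such a state is zero while all heights are nonnegative, so no mass
  can sit at positive height.\<close>

lemma support_in_F:
  assumes "\<Phi> \<in> states \<rho>s" "\<omega> \<in> \<Omega>" "\<omega> \<notin> F"
  shows "Pr \<omega> \<Phi> = 0"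
proof -
  have "(\<Sum>\<omega>\<in>\<Omega>. (norm (Pr \<omega> \<Phi>))\<^sup>2 * d \<omega>) = 0"
    using states_inner_diff[OF assms(1), of S "\<gamma> \<bullet> S"] rho_S by (simp add: d_def)
  then have "(norm (Pr \<omega> \<Phi>))\<^sup>2 * d \<omega> = 0"
    using assms d_nonneg finite_weights by (subst (asm) sum_nonneg_eq_0_iff) auto
  then show ?thesis using d_pos assms by force
qed

text \<open>This is the only use of genericity: by Caratheodory, the weights carrying a state
  over \<open>\<rho>s\<close> affinely span the facet.\<close>

lemma affine_hull_support:
  assumes \<Phi>: "\<Phi> \<in> states \<rho>s"
  shows "affine hull {\<omega>\<in>\<Omega>. Pr \<omega> \<Phi> \<noteq> 0} = affine hull F"
proof -
  define T where "T = {\<omega>\<in>\<Omega>. Pr \<omega> \<Phi> \<noteq> 0}"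
  have TF: "T \<subseteq> \<Omega> \<inter> F" using support_in_F[OF \<Phi>] by (auto simp: T_def)
  have fT: "finite T" using finite_weights by (simp add: T_def)
  have sumT: "(\<Sum>\<omega>\<in>T. f \<omega>) = (\<Sum>\<omega>\<in>\<Omega>. f \<omega>)" if "\<And>\<omega>. \<omega> \<in> \<Omega> \<Longrightarrow> Pr \<omega> \<Phi> = 0 \<Longrightarrow> f \<omega> = 0"
    for f :: "'v \<Rightarrow> 'b::comm_monoid_add"
    using that finite_weights by (intro sum.mono_neutral_left) (auto simp: T_def)
  have "(\<Sum>\<omega>\<in>T. (norm (Pr \<omega> \<Phi>))\<^sup>2) = 1"
    using \<Phi> norm_power2_eq_sum_Pr[of \<Phi>] by (subst sumT) (auto simp: states_def)
  moreover have "(\<Sum>\<omega>\<in>T. (norm (Pr \<omega> \<Phi>))\<^sup>2 *\<^sub>R \<omega>) = \<rho>s"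
    using \<Phi> by (subst sumT) (auto simp: states_def dens_def)
  ultimately have "\<rho>s \<in> convex hull T"
    unfolding convex_hull_finite[OF fT]
    by (intro CollectI exI[of _ "\<lambda>\<omega>. (norm (Pr \<omega> \<Phi>))\<^sup>2"]) auto
  then obtain U where U: "U \<subseteq> T" "int (card U) \<le> aff_dim T + 1" "\<rho>s \<in> convex hull U"
    using caratheodory_aff_dim[of T] by blast
  \<comment> \<open>Caratheodory allows at most \<open>aff_dim T + 1\<close> points and genericity
    demands more than \<open>aff_dim F\<close>, which gives the nontrivial inequality of
    dimensions.\<close>
  have "\<not> card U \<le> nat (aff_dim F)" using rho_generic[of U] U TF by blast
  with U have "aff_dim F \<le> aff_dim T" by linarith
  moreover have "aff_dim T \<le> aff_dim F" using TF by (intro aff_dim_subset) auto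
  ultimately have "aff_dim T = aff_dim F" by simp
  then show ?thesis unfolding T_def[symmetric]
    using aff_dim_eq_full_gen[of T F] TF by blast
qed

text \<open>The pair is the correction still owed after adding an outer \<open>x\<close>: squared
  norm must return to its old value and the density must end at a shift by
  \<open>\<epsilon> *\<^sub>R \<eta>\<close>. The value of the gap says precisely that the owed
  direction has height zero, hence lies along the facet and is reachable from the support of
  \<open>\<Phi>\<close>.\<close>

lemma gap_shift_in_span:
  assumes \<Phi>: "\<Phi> \<in> states \<rho>s" and gap: "gap x = \<epsilon>"
  shows "(- (norm x)\<^sup>2, \<epsilon> *\<^sub>R \<eta> - dens x) \<in> span (Pair 1 ` {\<omega>\<in>\<Omega>. Pr \<omega> \<Phi> \<noteq> 0})"
proof -
  let ?A = "Pair (1::real) ` {\<omega>\<in>\<Omega>. Pr \<omega> \<Phi> \<noteq> 0}"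
  have eq: "dens x - (norm x)\<^sup>2 *\<^sub>R \<gamma> = (\<Sum>\<omega>\<in>\<Omega>. (norm (Pr \<omega> x))\<^sup>2 *\<^sub>R (\<omega> - \<gamma>))"
    by (simp add: dens_def norm_power2_eq_sum_Pr[of x] scaleR_sum_left scaleR_diff_right sum_subtractf)
  \<comment> \<open>Subtracting mass times \<open>\<gamma>\<close> turns the density of
    \<open>x\<close> into a combination of differences \<open>\<omega> - \<gamma>\<close>, that is,
    into a direction.\<close>
  define v where "v = \<epsilon> *\<^sub>R \<eta> - (dens x - (norm x)\<^sup>2 *\<^sub>R \<gamma>)"
  have "\<omega> - \<gamma> \<in> D" if "\<omega> \<in> \<Omega>" for \<omega> using that by (auto simp: D_def intro: hull_inc)
  then have "v \<in> D" unfolding v_def eq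
    by (metis (no_types, lifting) eta_in_D subspace_D subspace_diff subspace_scale subspace_sum)
  moreover have "v \<bullet> S = 0"
    unfolding v_def eq using gap S_eta
    by (simp add: gap_def d_def inner_diff_left inner_sum_left)
  ultimately have "\<gamma> + v \<in> affine hull F"
    by (intro level_set_subset) (auto simp: D_def inner_add_left)
  then have "(1, \<gamma> + v) \<in> span ?A" "(1, \<gamma>) \<in> span ?A"
    using Pair_1_in_span_of_affine_hull affine_hull_support[OF \<Phi>] gamma by metis+
  then have "(1, \<gamma> + v) - (1, \<gamma>) - (norm x)\<^sup>2 *\<^sub>R (1, \<gamma>) \<in> span ?A"
    by (intro span_diff span_scale)
  moreover have "(1, \<gamma> + v) - (1, \<gamma>) - (norm x)\<^sup>2 *\<^sub>R (1, \<gamma>) = (- (norm x)\<^sup>2, \<epsilon> *\<^sub>R \<eta> - dens x)"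
    by (simp add: v_def)
  ultimately show ?thesis by metis
qed

text \<open>The finitely many outer heights have a positive minimum \<open>m\<close>, so on outer
  vectors the gap controls the squared norm. Everything quadratic in \<open>x\<close> is then of the
  order of the gap.\<close>

lemma gap_shift_bound:
  obtains K where "K \<ge> 0"
    "\<And>x. (\<And>\<omega>. \<omega> \<in> \<Omega> \<inter> F \<Longrightarrow> Pr \<omega> x = 0) \<Longrightarrow> (norm x)\<^sup>2 \<le> K * gap x"
    "\<And>x. (\<And>\<omega>. \<omega> \<in> \<Omega> \<inter> F \<Longrightarrow> Pr \<omega> x = 0) \<Longrightarrow>
       norm (- (norm x)\<^sup>2, gap x *\<^sub>R \<eta> - dens x) \<le> K * gap x"
proof -
  define m where "m = Min (d ` (\<Omega> - F))"
  have m: "m > 0" "\<And>\<omega>. \<omega> \<in> \<Omega> \<Longrightarrow> \<omega> \<notin> F \<Longrightarrow> m \<le> d \<omega>"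
    using outer_weight_exists finite_weights d_pos by (auto simp: m_def)
  have gap0: "gap x \<ge> 0" for x unfolding gap_def using d_nonneg by (intro sum_nonneg) auto
  have 1: "(norm x)\<^sup>2 \<le> (1 / m) * gap x" if "\<And>\<omega>. \<omega> \<in> \<Omega> \<inter> F \<Longrightarrow> Pr \<omega> x = 0" for x
  proof -
    have "m * (norm x)\<^sup>2 \<le> gap x"
      unfolding norm_power2_eq_sum_Pr[of x] gap_def sum_distrib_left
    proof (rule sum_mono)
      fix \<omega> assume \<omega>: "\<omega> \<in> \<Omega>"
      show "m * (norm (Pr \<omega> x))\<^sup>2 \<le> (norm (Pr \<omega> x))\<^sup>2 * d \<omega>"
        using that[of \<omega>] m(2)[of \<omega>] \<omega>
        by (cases "\<omega> \<in> F") (auto simp: mult.commute intro: mult_right_mono)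
    qed
    then show ?thesis using m by (simp add: field_simps)
  qed
  define M where "M = (\<Sum>\<omega>\<in>\<Omega>. norm \<omega>)"
  have M0: "M \<ge> 0" by (simp add: M_def sum_nonneg)
  have dM: "norm (dens x) \<le> M * (norm x)\<^sup>2" for x
  proof -
    have "norm (dens x) \<le> (\<Sum>\<omega>\<in>\<Omega>. norm \<omega> * (norm x)\<^sup>2)"
      unfolding dens_def
    proof (rule sum_norm_le)
      fix \<omega> assume "\<omega> \<in> \<Omega>"
      then have "(norm (Pr \<omega> x))\<^sup>2 \<le> (norm x)\<^sup>2" by (intro power_mono norm_Pr_le) auto
      then show "norm ((norm (Pr \<omega> x))\<^sup>2 *\<^sub>R \<omega>) \<le> norm \<omega> * (norm x)\<^sup>2"
        by (simp add: mult.commute mult_left_mono)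
    qed
    then show ?thesis by (simp add: M_def sum_distrib_right)
  qed
  \<comment> \<open>Mass and density of \<open>x\<close> together cost \<open>(1 + M) / m\<close>
    per unit of gap, and the prescribed shift costs \<open>norm \<eta>\<close>.\<close>
  define K where "K = (1 + M) / m + norm \<eta>"
  show thesis
  proof (rule that[of K])
    show "K \<ge> 0" using m M0 by (simp add: K_def)
    fix x assume x: "\<And>\<omega>. \<omega> \<in> \<Omega> \<inter> F \<Longrightarrow> Pr \<omega> x = 0"
    have "1 / m \<le> K" using m M0 by (simp add: K_def add_divide_distrib)
    then show "(norm x)\<^sup>2 \<le> K * gap x"
      using 1[OF x] gap0[of x] by (meson mult_right_mono order_trans)
    have "norm (- (norm x)\<^sup>2, gap x *\<^sub>R \<eta> - dens x) \<le> (norm x)\<^sup>2 + (gap x * norm \<eta> + norm (dens x))"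
      using gap0[of x] norm_triangle_ineq4[of "gap x *\<^sub>R \<eta>" "dens x"]
      by (intro order_trans[OF norm_Pair_le]) auto
    also have "\<dots> \<le> (1 + M) * (norm x)\<^sup>2 + gap x * norm \<eta>"
      using dM[of x] by (simp add: algebra_simps)
    also have "\<dots> \<le> (1 + M) * ((1 / m) * gap x) + gap x * norm \<eta>"
      using 1[OF x] M0 by (intro add_right_mono mult_left_mono) auto
    also have "\<dots> = K * gap x" by (simp add: K_def algebra_simps)
    finally show "norm (- (norm x)\<^sup>2, gap x *\<^sub>R \<eta> - dens x) \<le> K * gap x" .
  qed
qed

text \<open>In each weight space at most one of the two parts is nonzero, so norm and density have
  no mixed terms; the energy does, because \<open>W\<close> mixes weight spaces.\<close>

lemma split_add:
  assumes y: "\<And>\<omega>. \<omega> \<in> \<Omega> - F \<Longrightarrow> Pr \<omega> y = 0" and x: "\<And>\<omega>. \<omega> \<in> \<Omega> \<inter> F \<Longrightarrow> Pr \<omega> x = 0"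
  shows "(norm (y + x))\<^sup>2 = (norm y)\<^sup>2 + (norm x)\<^sup>2" "dens (y + x) = dens y + dens x"
proof -
  have *: "(norm (Pr \<omega> (y + x)))\<^sup>2 = (norm (Pr \<omega> y))\<^sup>2 + (norm (Pr \<omega> x))\<^sup>2" if "\<omega> \<in> \<Omega>" for \<omega>
    using x[of \<omega>] y[of \<omega>] that by (cases "\<omega> \<in> F") (auto simp: Pr_add)
  show "(norm (y + x))\<^sup>2 = (norm y)\<^sup>2 + (norm x)\<^sup>2"
    unfolding norm_power2_eq_sum_Pr[of y] norm_power2_eq_sum_Pr[of x] norm_power2_eq_sum_Pr[of "y + x"]
    by (simp add: * sum.distrib)
  show "dens (y + x) = dens y + dens x"
    by (simp add: dens_def * sum.distrib scaleR_add_left)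
qed

section \<open>The extremal problem for the cross term at fixed gap\<close>

lemma R_nonneg: "R x \<ge> 0"
  unfolding R_def by (intro real_sqrt_ge_zero sum_nonneg divide_nonneg_nonneg d_nonneg) auto

lemma outer_inner_eq:
  assumes x: "\<And>\<omega>. \<omega> \<in> \<Omega> \<inter> F \<Longrightarrow> Pr \<omega> x = 0"
  shows "x \<bullet> y = (\<Sum>\<omega>\<in>\<Omega> - F. Pr \<omega> x \<bullet> Pr \<omega> y)"
  unfolding inner_eq_sum_Pr[of x y]
  using x finite_weights by (intro sum.mono_neutral_right) auto

lemma gap_eq_outer: "gap x = (\<Sum>\<omega>\<in>\<Omega> - F. (norm (Pr \<omega> x))\<^sup>2 * d \<omega>)"
  unfolding gap_def using finite_weights d_zero by (intro sum.mono_neutral_right) auto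

text \<open>Each summand is split with \<open>sqrt (d \<omega>)\<close> on one factor and its
  inverse on the other, so that the first factor assembles to the gap and the second to
  \<open>R\<close>.\<close>

lemma cross_term_bound:
  assumes x: "\<And>\<omega>. \<omega> \<in> \<Omega> \<inter> F \<Longrightarrow> Pr \<omega> x = 0"
  shows "\<bar>x \<bullet> W y\<bar> \<le> sqrt (gap x) * R y"
proof -
  have eq: "x \<bullet> W y = (\<Sum>\<omega>\<in>\<Omega> - F. Pr \<omega> x \<bullet> Pr \<omega> (W y))"
    by (rule outer_inner_eq) (rule x)
  have "\<bar>x \<bullet> W y\<bar> \<le> (\<Sum>\<omega>\<in>\<Omega> - F. \<bar>norm (Pr \<omega> x) * sqrt (d \<omega>)\<bar> * \<bar>norm (Pr \<omega> (W y)) / sqrt (d \<omega>)\<bar>)"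
    unfolding eq
  proof (rule order_trans[OF sum_abs sum_mono])
    fix \<omega> assume "\<omega> \<in> \<Omega> - F"
    then have "d \<omega> > 0" using d_pos by blast
    then show "\<bar>Pr \<omega> x \<bullet> Pr \<omega> (W y)\<bar> \<le> \<bar>norm (Pr \<omega> x) * sqrt (d \<omega>)\<bar> * \<bar>norm (Pr \<omega> (W y)) / sqrt (d \<omega>)\<bar>"
      using Cauchy_Schwarz_ineq2[of "Pr \<omega> x" "Pr \<omega> (W y)"] by (simp add: abs_mult)
  qed
  also have "\<dots> \<le> L2_set (\<lambda>\<omega>. norm (Pr \<omega> x) * sqrt (d \<omega>)) (\<Omega> - F)
      * L2_set (\<lambda>\<omega>. norm (Pr \<omega> (W y)) / sqrt (d \<omega>)) (\<Omega> - F)"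
    by (rule L2_set_mult_ineq)
  also have "L2_set (\<lambda>\<omega>. norm (Pr \<omega> x) * sqrt (d \<omega>)) (\<Omega> - F) = sqrt (gap x)"
    unfolding L2_set_def gap_eq_outer using d_nonneg
    by (intro arg_cong[where f=sqrt] sum.cong) (auto simp: power_mult_distrib)
  also have "L2_set (\<lambda>\<omega>. norm (Pr \<omega> (W y)) / sqrt (d \<omega>)) (\<Omega> - F) = R y"
    unfolding L2_set_def R_def using d_nonneg
    by (intro arg_cong[where f=sqrt] sum.cong) (auto simp: power_divide)
  finally show ?thesis .
qed

text \<open>The equality case of the weighted Cauchy-Schwarz inequality: components proportional to
  those of \<open>W \<Phi>\<close> divided by the height, with negative sign and normalized by
  \<open>R \<Phi>\<close>. When \<open>R \<Phi> = 0\<close> this formula degenerates, but then every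
  outer vector has vanishing cross term and any one of unit gap will do.\<close>

lemma optimal_direction:
  obtains \<xi> where "\<And>\<omega>. \<omega> \<in> \<Omega> \<inter> F \<Longrightarrow> Pr \<omega> \<xi> = 0" "gap \<xi> = 1" "\<xi> \<bullet> W \<Phi> = - R \<Phi>"
proof (cases "R \<Phi> = 0")
  case True
  obtain \<omega>0 where \<omega>0: "\<omega>0 \<in> \<Omega>" "\<omega>0 \<notin> F" using outer_weight_exists by blast
  then obtain z where z: "Pr \<omega>0 z \<noteq> 0" using Pr_nontrivial by blast
  define c where "c = 1 / (norm (Pr \<omega>0 z) * sqrt (d \<omega>0))"
  define \<xi> where "\<xi> = (\<Sum>\<omega>\<in>{\<omega>0}. c *\<^sub>R Pr \<omega> z)"
  have P: "Pr \<omega> \<xi> = (if \<omega> \<in> {\<omega>0} then c *\<^sub>R Pr \<omega> z else 0)" if "\<omega> \<in> \<Omega>" for \<omega>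
    unfolding \<xi>_def using Pr_sum_scaleR[of "{\<omega>0}" \<omega> "\<lambda>_. c" z] \<omega>0 that by simp
  have out: "Pr \<omega> \<xi> = 0" if "\<omega> \<in> \<Omega> \<inter> F" for \<omega> using P[of \<omega>] that \<omega>0 by auto
  have "gap \<xi> = (\<Sum>\<omega>\<in>\<Omega>. if \<omega> = \<omega>0 then (norm (c *\<^sub>R Pr \<omega>0 z))\<^sup>2 * d \<omega>0 else 0)"
    unfolding gap_def by (intro sum.cong) (auto simp: P)
  also have "\<dots> = (norm (c *\<^sub>R Pr \<omega>0 z))\<^sup>2 * d \<omega>0" using \<omega>0 finite_weights by (simp add: sum.delta)
  also have "\<dots> = 1" using z d_pos[OF \<omega>0] by (simp add: c_def power_mult_distrib power_divide)
  finally have "gap \<xi> = 1" .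
  moreover from cross_term_bound[OF out, of \<Phi>] have "\<xi> \<bullet> W \<Phi> = - R \<Phi>" using True by simp
  ultimately show ?thesis using that[of \<xi>] out by blast
next
  case False
  then have Rp: "R \<Phi> > 0" using R_nonneg[of \<Phi>] by simp
  define \<xi> where "\<xi> = (\<Sum>\<omega>\<in>\<Omega> - F. (- 1 / (R \<Phi> * d \<omega>)) *\<^sub>R Pr \<omega> (W \<Phi>))"
  have P: "Pr \<omega> \<xi> = (if \<omega> \<in> \<Omega> - F then (- 1 / (R \<Phi> * d \<omega>)) *\<^sub>R Pr \<omega> (W \<Phi>) else 0)" if "\<omega> \<in> \<Omega>" for \<omega>
    unfolding \<xi>_def using that by (intro Pr_sum_scaleR) auto
  have out: "Pr \<omega> \<xi> = 0" if "\<omega> \<in> \<Omega> \<inter> F" for \<omega> using P[of \<omega>] that by auto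
  have R2: "(\<Sum>\<omega>\<in>\<Omega> - F. (norm (Pr \<omega> (W \<Phi>)))\<^sup>2 / d \<omega>) = (R \<Phi>)\<^sup>2"
    unfolding R_def using d_nonneg by (subst real_sqrt_pow2) (auto intro!: sum_nonneg divide_nonneg_nonneg)
  have "gap \<xi> = (\<Sum>\<omega>\<in>\<Omega> - F. (1 / (R \<Phi>)\<^sup>2) * ((norm (Pr \<omega> (W \<Phi>)))\<^sup>2 / d \<omega>))"
    unfolding gap_eq_outer
  proof (intro sum.cong refl)
    fix \<omega> assume "\<omega> \<in> \<Omega> - F"
    then show "(norm (Pr \<omega> \<xi>))\<^sup>2 * d \<omega> = (1 / (R \<Phi>)\<^sup>2) * ((norm (Pr \<omega> (W \<Phi>)))\<^sup>2 / d \<omega>)"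
      using d_pos[of \<omega>] Rp P[of \<omega>]
      by (simp add: power_mult_distrib power_divide) (simp add: field_simps power2_eq_square)
  qed
  also have "\<dots> = 1" unfolding sum_distrib_left[symmetric] R2 using Rp by simp
  finally have "gap \<xi> = 1" .
  moreover have "\<xi> \<bullet> W \<Phi> = - R \<Phi>"
  proof -
    have "\<xi> \<bullet> W \<Phi> = (\<Sum>\<omega>\<in>\<Omega> - F. Pr \<omega> \<xi> \<bullet> Pr \<omega> (W \<Phi>))"
      by (rule outer_inner_eq) (rule out)
    also have "\<dots> = (\<Sum>\<omega>\<in>\<Omega> - F. (- 1 / R \<Phi>) * ((norm (Pr \<omega> (W \<Phi>)))\<^sup>2 / d \<omega>))"
      by (intro sum.cong) (auto simp: P power2_norm_eq_inner)
    also have "\<dots> = - R \<Phi>" unfolding sum_distrib_left[symmetric] R2 using Rp by (simp add: power2_eq_square)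
    finally show ?thesis .
  qed
  ultimately show ?thesis using that[of \<xi>] out by blast
qed

end

section \<open>The square-root expansion\<close>

context facet_resolution
begin

section \<open>Upper and lower energy estimates near the facet\<close>

lemma energy_bound:
  assumes "\<And>x. norm (W x) \<le> B * norm x"
  shows "\<bar>x \<bullet> W y\<bar> \<le> B * norm x * norm y"
proof -
  have "\<bar>x \<bullet> W y\<bar> \<le> norm x * norm (W y)" by (rule Cauchy_Schwarz_ineq2)
  also have "\<dots> \<le> norm x * (B * norm y)" using assms by (intro mult_left_mono) auto
  finally show ?thesis by (simp add: mult_ac)
qed

text \<open>The trial state is \<open>\<Phi>\<close> plus \<open>sqrt \<epsilon>\<close> times the
  optimal direction, followed by a repair \<open>g\<close> of order \<open>\<epsilon>\<close>.
  Nonemptiness is part of the conclusion because the infimum over an empty set carries no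
  information; the lower estimate needs it as well.\<close>

lemma Fp_upper_bound:
  assumes \<Phi>: "\<Phi> \<in> states \<rho>s"
  shows "\<exists>C. \<forall>\<^sub>F \<epsilon> in at_right 0. states (\<rho>s + \<epsilon> *\<^sub>R \<eta>) \<noteq> {} \<and>
     Fp (\<rho>s + \<epsilon> *\<^sub>R \<eta>) \<le> energy \<Phi> - 2 * sqrt \<epsilon> * R \<Phi> + C * \<epsilon>"
proof -
  obtain \<xi> where \<xi>: "\<And>\<omega>. \<omega> \<in> \<Omega> \<inter> F \<Longrightarrow> Pr \<omega> \<xi> = 0" "gap \<xi> = 1" "\<xi> \<bullet> W \<Phi> = - R \<Phi>"
    using optimal_direction[of \<Phi>] by metis
  obtain B where B: "B \<ge> 0" "\<And>x. norm (W x) \<le> B * norm x" using W_bound by metis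
  obtain K where K: "K \<ge> 0" "\<And>x. (\<And>\<omega>. \<omega> \<in> \<Omega> \<inter> F \<Longrightarrow> Pr \<omega> x = 0) \<Longrightarrow>
       norm (- (norm x)\<^sup>2, gap x *\<^sub>R \<eta> - dens x) \<le> K * gap x"
    using gap_shift_bound by metis
  obtain \<delta> C1 where \<delta>: "\<delta> > 0" and C1: "C1 \<ge> 0" and adj:
    "\<And>\<Psi> m z. norm (\<Psi> - \<Phi>) < \<delta> \<Longrightarrow> norm (m::real, z) < \<delta> \<Longrightarrow>
       (m, z) \<in> span (Pair 1 ` {\<omega>\<in>\<Omega>. Pr \<omega> \<Phi> \<noteq> 0}) \<Longrightarrow>
       \<exists>\<Psi>'. norm (\<Psi>' - \<Psi>) \<le> C1 * norm (m, z) \<and> (norm \<Psi>')\<^sup>2 = (norm \<Psi>)\<^sup>2 + m \<and>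
            dens \<Psi>' = dens \<Psi> + z"
    using adjust_state[of \<Phi>] by blast
  define c where "c = C1 * K"
  \<comment> \<open>The first summand pays for the cross term of the repair with
    \<open>W \<Phi>\<close>, the second for the energy of the whole displacement
    \<open>x + g\<close>.\<close>
  define C where "C = 2 * B * c + B * (norm \<xi> + c)\<^sup>2"
  have c0: "c \<ge> 0" using C1 K by (simp add: c_def)
  have main: "states (\<rho>s + \<epsilon> *\<^sub>R \<eta>) \<noteq> {} \<and>
     Fp (\<rho>s + \<epsilon> *\<^sub>R \<eta>) \<le> energy \<Phi> - 2 * sqrt \<epsilon> * R \<Phi> + C * \<epsilon>"
    if e: "0 < \<epsilon>" "\<epsilon> < 1" "sqrt \<epsilon> * norm \<xi> < \<delta>" "K * \<epsilon> < \<delta>" for \<epsilon>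
  proof -
    define x where "x = sqrt \<epsilon> *\<^sub>R \<xi>"
    have Px: "Pr \<omega> x = sqrt \<epsilon> *\<^sub>R Pr \<omega> \<xi>" if "\<omega> \<in> \<Omega>" for \<omega> using that by (simp add: x_def Pr_scale)
    have out: "Pr \<omega> x = 0" if "\<omega> \<in> \<Omega> \<inter> F" for \<omega> using \<xi>(1) Px that by simp
    have gx: "gap x = \<epsilon>"
    proof -
      have "gap x = \<epsilon> * gap \<xi>"
        unfolding gap_def sum_distrib_left using e by (intro sum.cong) (auto simp: Px power_mult_distrib)
      then show ?thesis by (simp add: \<xi>)
    qed
    let ?m = "- (norm x)\<^sup>2" and ?z = "\<epsilon> *\<^sub>R \<eta> - dens x"
    have small: "norm (?m, ?z) \<le> K * \<epsilon>" using K(2)[of x] out gx by simp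
    have "\<exists>\<Psi>'. norm (\<Psi>' - (\<Phi> + x)) \<le> C1 * norm (?m, ?z) \<and> (norm \<Psi>')\<^sup>2 = (norm (\<Phi> + x))\<^sup>2 + ?m \<and>
            dens \<Psi>' = dens (\<Phi> + x) + ?z"
    proof (rule adj)
      show "norm (\<Phi> + x - \<Phi>) < \<delta>" using e by (simp add: x_def)
      show "norm (?m, ?z) < \<delta>" using small e by linarith
      show "(?m, ?z) \<in> span (Pair 1 ` {\<omega>\<in>\<Omega>. Pr \<omega> \<Phi> \<noteq> 0})"
        by (rule gap_shift_in_span[OF \<Phi> gx])
    qed
    then obtain \<Psi> where \<Psi>: "norm (\<Psi> - (\<Phi> + x)) \<le> C1 * norm (?m, ?z)"
      "(norm \<Psi>)\<^sup>2 = (norm (\<Phi> + x))\<^sup>2 + ?m" "dens \<Psi> = dens (\<Phi> + x) + ?z" by blast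
    have sp: "(norm (\<Phi> + x))\<^sup>2 = (norm \<Phi>)\<^sup>2 + (norm x)\<^sup>2" "dens (\<Phi> + x) = dens \<Phi> + dens x"
      using split_add[of \<Phi> x] support_in_F[OF \<Phi>] out by auto
    have st: "\<Psi> \<in> states (\<rho>s + \<epsilon> *\<^sub>R \<eta>)"
      using \<Psi>(2,3) \<Phi> sp by (simp add: states_def abs_square_eq_1)
    define g where "g = \<Psi> - (\<Phi> + x)"
    have g: "norm g \<le> c * \<epsilon>"
    proof -
      have "C1 * norm (?m, ?z) \<le> C1 * (K * \<epsilon>)" using small C1 by (rule mult_left_mono)
      then show ?thesis using \<Psi>(1) by (simp add: g_def c_def mult.assoc)
    qed
    \<comment> \<open>Since \<open>\<epsilon> < 1\<close>, the repair is also of order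
      \<open>sqrt \<epsilon>\<close>, so the displacement has squared norm of order
      \<open>\<epsilon>\<close>.\<close>
    have "\<epsilon> \<le> sqrt \<epsilon>" using e by (simp add: real_le_rsqrt power2_eq_square mult_left_le)
    then have "c * \<epsilon> \<le> c * sqrt \<epsilon>" using c0 by (rule mult_left_mono)
    with g have h: "norm (x + g) \<le> sqrt \<epsilon> * (norm \<xi> + c)"
      using norm_triangle_ineq[of x g] e by (simp add: x_def algebra_simps)
    have "energy \<Psi> = energy (\<Phi> + (x + g))" by (simp add: g_def)
    also have "\<dots> = energy \<Phi> + 2 * (x \<bullet> W \<Phi>) + 2 * (g \<bullet> W \<Phi>) + energy (x + g)"
      by (simp only: energy_add[of \<Phi> "x + g"] inner_add_left) simp
    also have "x \<bullet> W \<Phi> = - (sqrt \<epsilon> * R \<Phi>)" by (simp add: x_def \<xi>)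
    finally have E: "energy \<Psi> = energy \<Phi> - 2 * sqrt \<epsilon> * R \<Phi> + 2 * (g \<bullet> W \<Phi>) + energy (x + g)"
      by simp
    have "g \<bullet> W \<Phi> \<le> B * norm g * norm \<Phi>" using energy_bound[OF B(2), of g \<Phi>] by linarith
    also have "\<dots> \<le> B * (c * \<epsilon>)" using \<Phi> g B by (simp add: states_def mult_left_mono)
    finally have 1: "g \<bullet> W \<Phi> \<le> B * (c * \<epsilon>)" .
    have "energy (x + g) \<le> B * norm (x + g) * norm (x + g)"
      using energy_bound[OF B(2), of "x + g" "x + g"] unfolding energy_def by linarith
    also have "\<dots> = B * (norm (x + g))\<^sup>2" by (simp add: power2_eq_square)
    also have "\<dots> \<le> B * (sqrt \<epsilon> * (norm \<xi> + c))\<^sup>2"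
      using h B by (intro mult_left_mono power_mono) auto
    also have "\<dots> = B * (norm \<xi> + c)\<^sup>2 * \<epsilon>" using e by (simp add: power_mult_distrib)
    finally have 2: "energy (x + g) \<le> B * (norm \<xi> + c)\<^sup>2 * \<epsilon>" .
    have "energy \<Psi> \<le> energy \<Phi> - 2 * sqrt \<epsilon> * R \<Phi> + C * \<epsilon>"
      using E 1 2 by (simp add: C_def algebra_simps)
    then show ?thesis using st Fp_le[OF st] by auto
  qed
  have "\<forall>\<^sub>F \<epsilon> in at_right (0::real). 0 < \<epsilon> \<and> \<epsilon> < 1 \<and> sqrt \<epsilon> * norm \<xi> < \<delta> \<and> K * \<epsilon> < \<delta>"
  proof (intro eventually_conj)
    show "\<forall>\<^sub>F \<epsilon> in at_right (0::real). 0 < \<epsilon>" by (simp add: eventually_at_right_less)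
    show "\<forall>\<^sub>F \<epsilon> in at_right (0::real). \<epsilon> < 1"
      by (rule order_tendstoD(2)[OF tendsto_ident_at]) simp
    have "((\<lambda>\<epsilon>. sqrt \<epsilon> * norm \<xi>) \<longlongrightarrow> sqrt 0 * norm \<xi>) (at_right 0)"
      by (intro tendsto_intros)
    then show "\<forall>\<^sub>F \<epsilon> in at_right (0::real). sqrt \<epsilon> * norm \<xi> < \<delta>"
      using \<delta> by (intro order_tendstoD(2)) auto
    have "((\<lambda>\<epsilon>. K * \<epsilon>) \<longlongrightarrow> K * 0) (at_right 0)" by (intro tendsto_intros)
    then show "\<forall>\<^sub>F \<epsilon> in at_right (0::real). K * \<epsilon> < \<delta>"
      using \<delta> by (intro order_tendstoD(2)) auto
  qed
  then show ?thesis by (intro exI[of _ C]) (auto elim!: eventually_mono dest!: main)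
qed

text \<open>The upper construction run backwards: deleting the outer part of \<open>\<Psi>\<close>
  and repairing the rest gives a competitor at \<open>\<rho>s\<close>. The vector
  \<open>\<Phi>\<close> only anchors the estimate: near it the components to be rescaled stay away
  from zero, so \<open>\<delta>\<close> and \<open>C\<close> serve all nearby
  \<open>\<Psi>\<close>.\<close>

lemma energy_lower_bound_near:
  assumes \<Phi>: "\<Phi> \<in> states \<rho>s"
  shows "\<exists>\<delta>>0. \<exists>C. \<forall>\<epsilon> \<Psi>. 0 < \<epsilon> \<longrightarrow> \<epsilon> < \<delta> \<longrightarrow> \<Psi> \<in> states (\<rho>s + \<epsilon> *\<^sub>R \<eta>) \<longrightarrow> norm (\<Psi> - \<Phi>) < \<delta> \<longrightarrow>
     Fp \<rho>s - 2 * sqrt \<epsilon> * R \<Psi> - C * \<epsilon> \<le> energy \<Psi>"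
proof -
  obtain B where B: "B \<ge> 0" "\<And>x. norm (W x) \<le> B * norm x" using W_bound by metis
  obtain K where K: "K \<ge> 0"
    "\<And>x. (\<And>\<omega>. \<omega> \<in> \<Omega> \<inter> F \<Longrightarrow> Pr \<omega> x = 0) \<Longrightarrow> (norm x)\<^sup>2 \<le> K * gap x"
    "\<And>x. (\<And>\<omega>. \<omega> \<in> \<Omega> \<inter> F \<Longrightarrow> Pr \<omega> x = 0) \<Longrightarrow>
       norm (- (norm x)\<^sup>2, gap x *\<^sub>R \<eta> - dens x) \<le> K * gap x"
    using gap_shift_bound by metis
  obtain \<delta>0 C1 where \<delta>0: "\<delta>0 > 0" and C1: "C1 \<ge> 0" and adj:
    "\<And>\<Psi> m z. norm (\<Psi> - \<Phi>) < \<delta>0 \<Longrightarrow> norm (m::real, z) < \<delta>0 \<Longrightarrow>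
       (m, z) \<in> span (Pair 1 ` {\<omega>\<in>\<Omega>. Pr \<omega> \<Phi> \<noteq> 0}) \<Longrightarrow>
       \<exists>\<Psi>'. norm (\<Psi>' - \<Psi>) \<le> C1 * norm (m, z) \<and> (norm \<Psi>')\<^sup>2 = (norm \<Psi>)\<^sup>2 + m \<and>
            dens \<Psi>' = dens \<Psi> + z"
    using adjust_state[of \<Phi>] by blast
  define c where "c = C1 * K"
  \<comment> \<open>The three summands pay for the cross term of the repair, its own energy, and the
    energy of the outer part.\<close>
  define C where "C = 2 * B * c + B * c\<^sup>2 + B * K"
  \<comment> \<open>In order: \<open>\<epsilon>^2 \<le> \<epsilon>\<close>; half of
    \<open>\<delta>0\<close> for the distance to \<open>\<Phi>\<close>; the other half for
    \<open>norm x\<close>, whose square is at most \<open>K * \<epsilon>\<close>; and a defect below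
    \<open>\<delta>0\<close>. The denominator \<open>K + 1\<close> allows
    \<open>K = 0\<close>.\<close>
  define \<delta> where "\<delta> = Min {1, \<delta>0 / 2, (\<delta>0 / 2)\<^sup>2 / (K + 1), \<delta>0 / (K + 1)}"
  have c0: "c \<ge> 0" using C1 K by (simp add: c_def)
  have \<delta>: "\<delta> > 0" "\<delta> \<le> 1" "\<delta> \<le> \<delta>0 / 2" "\<delta> \<le> (\<delta>0 / 2)\<^sup>2 / (K + 1)" "\<delta> \<le> \<delta>0 / (K + 1)"
  proof -
    show "\<delta> > 0" using \<delta>0 K(1) by (auto simp: \<delta>_def)
  qed (unfold \<delta>_def, (rule Min_le; simp)+)
  have K1: "K * \<epsilon> < a" if "0 < \<epsilon>" "\<epsilon> < \<delta>" "\<delta> \<le> a / (K + 1)" for \<epsilon> a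
  proof -
    have "\<epsilon> < a / (K + 1)" using that by linarith
    then have "\<epsilon> * (K + 1) < a" using K(1) by (simp add: pos_less_divide_eq)
    then show ?thesis using that by (simp add: algebra_simps)
  qed
  have "Fp \<rho>s - 2 * sqrt \<epsilon> * R \<Psi> - C * \<epsilon> \<le> energy \<Psi>"
    if e: "0 < \<epsilon>" "\<epsilon> < \<delta>" and \<Psi>: "\<Psi> \<in> states (\<rho>s + \<epsilon> *\<^sub>R \<eta>)" and near: "norm (\<Psi> - \<Phi>) < \<delta>" for \<epsilon> \<Psi>
  proof -
    define x where "x = (\<Sum>\<omega>\<in>\<Omega> - F. 1 *\<^sub>R Pr \<omega> \<Psi>)"
    have Px: "Pr \<omega> x = (if \<omega> \<in> \<Omega> - F then 1 *\<^sub>R Pr \<omega> \<Psi> else 0)" if "\<omega> \<in> \<Omega>" for \<omega>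
      unfolding x_def using that by (intro Pr_sum_scaleR) auto
    have out: "Pr \<omega> x = 0" if "\<omega> \<in> \<Omega> \<inter> F" for \<omega> using Px that by simp
    define y where "y = \<Psi> - x"
    have inn: "Pr \<omega> y = 0" if "\<omega> \<in> \<Omega> - F" for \<omega> using Px that by (simp add: y_def Pr_diff)
    have \<Psi>yx: "\<Psi> = y + x" by (simp add: y_def)
    have gx: "gap x = \<epsilon>"
    proof -
      have "gap x = gap \<Psi>" unfolding gap_eq_outer by (intro sum.cong) (auto simp: Px)
      also have "\<dots> = (\<rho>s + \<epsilon> *\<^sub>R \<eta>) \<bullet> S - \<gamma> \<bullet> S"
        using states_inner_diff[OF \<Psi>, of S "\<gamma> \<bullet> S"] by (simp add: gap_def d_def)
      also have "\<dots> = \<epsilon>" using rho_S S_eta by (simp add: inner_add_left)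
      finally show ?thesis .
    qed
    have x2: "(norm x)\<^sup>2 \<le> K * \<epsilon>" using K(2)[of x] out gx by simp
    also have "\<dots> < (\<delta>0 / 2)\<^sup>2" by (rule K1[OF e \<delta>(4)])
    finally have xs: "norm x < \<delta>0 / 2" using \<delta>0 by (intro power_less_imp_less_base[of "norm x" 2]) auto
    let ?m = "(norm x)\<^sup>2" and ?z = "dens x - \<epsilon> *\<^sub>R \<eta>"
    \<comment> \<open>Removing \<open>x\<close> owes the negative of the correction for adding it,
      and a span is closed under negation.\<close>
    have neg: "(?m, ?z) = - (- ?m, \<epsilon> *\<^sub>R \<eta> - dens x)" by simp
    have small: "norm (?m, ?z) \<le> K * \<epsilon>" unfolding neg norm_minus_cancel using K(3)[of x] out gx by simp
    have "\<exists>\<Psi>'. norm (\<Psi>' - y) \<le> C1 * norm (?m, ?z) \<and> (norm \<Psi>')\<^sup>2 = (norm y)\<^sup>2 + ?m \<and>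
            dens \<Psi>' = dens y + ?z"
    proof (rule adj)
      have "norm (y - \<Phi>) \<le> norm (\<Psi> - \<Phi>) + norm x" unfolding y_def by norm
      then show "norm (y - \<Phi>) < \<delta>0" using near xs \<delta>(3) by linarith
      show "norm (?m, ?z) < \<delta>0" using small K1[OF e \<delta>(5)] by linarith
      show "(?m, ?z) \<in> span (Pair 1 ` {\<omega>\<in>\<Omega>. Pr \<omega> \<Phi> \<noteq> 0})"
        unfolding neg by (intro span_neg gap_shift_in_span[OF \<Phi> gx])
    qed
    then obtain y' where y': "norm (y' - y) \<le> C1 * norm (?m, ?z)"
      "(norm y')\<^sup>2 = (norm y)\<^sup>2 + ?m" "dens y' = dens y + ?z" by blast
    have sp: "(norm \<Psi>)\<^sup>2 = (norm y)\<^sup>2 + (norm x)\<^sup>2" "dens \<Psi> = dens y + dens x"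
      unfolding \<Psi>yx using split_add[of y x] inn out by auto
    have st: "y' \<in> states \<rho>s"
      using y'(2,3) \<Psi> sp by (auto simp: states_def abs_square_eq_1 add_diff_eq)
    define g where "g = y - y'"
    have g: "norm g \<le> c * \<epsilon>"
    proof -
      have "C1 * norm (?m, ?z) \<le> C1 * (K * \<epsilon>)" using small C1 by (rule mult_left_mono)
      then show ?thesis using y'(1) by (simp add: g_def c_def mult.assoc norm_minus_commute)
    qed
    have g2: "(norm g)\<^sup>2 \<le> c\<^sup>2 * \<epsilon>"
    proof -
      have "(norm g)\<^sup>2 \<le> (c * \<epsilon>)\<^sup>2" using g by (intro power_mono) auto
      also have "\<dots> = c\<^sup>2 * (\<epsilon> * \<epsilon>)" by (simp add: power2_eq_square)
      also have "\<dots> \<le> c\<^sup>2 * \<epsilon>" using e \<delta>(2) by (intro mult_left_mono) (auto simp: mult_left_le)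
      finally show ?thesis .
    qed
    have Ebound: "\<bar>energy u\<bar> \<le> B * (norm u)\<^sup>2" for u
      using energy_bound[OF B(2), of u u] by (simp add: energy_def power2_eq_square mult.assoc)
    have 1: "\<bar>g \<bullet> W y'\<bar> \<le> B * (c * \<epsilon>)"
    proof -
      have "\<bar>g \<bullet> W y'\<bar> \<le> B * norm g * norm y'" by (rule energy_bound[OF B(2)])
      also have "\<dots> \<le> B * (c * \<epsilon>)" using st g B by (simp add: states_def mult_left_mono)
      finally show ?thesis .
    qed
    have 2: "\<bar>energy g\<bar> \<le> B * (c\<^sup>2 * \<epsilon>)"
      using Ebound[of g] mult_left_mono[OF g2 B(1)] by linarith
    have 3: "\<bar>energy x\<bar> \<le> B * (K * \<epsilon>)"
      using Ebound[of x] mult_left_mono[OF x2 B(1)] by linarith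
    have 4: "\<bar>x \<bullet> W \<Psi>\<bar> \<le> sqrt \<epsilon> * R \<Psi>"
      using cross_term_bound[of x \<Psi>] out gx by simp
    have "energy y = energy y' + 2 * (g \<bullet> W y') + energy g"
      using energy_add[of y' g] by (simp add: g_def)
    \<comment> \<open>Expanding around \<open>\<Psi>\<close> rather than around \<open>y\<close>
      makes the cross term \<open>x \<bullet> W \<Psi>\<close>, which is bounded through
      \<open>R \<Psi>\<close>.\<close>
    moreover have "energy y = energy \<Psi> - 2 * (x \<bullet> W \<Psi>) + energy x"
      using energy_add[of \<Psi> "- x"] by (simp add: y_def energy_def linear_neg[OF W_linear])
    ultimately have "energy \<Psi> = energy y' + 2 * (g \<bullet> W y') + energy g + 2 * (x \<bullet> W \<Psi>) - energy x"
      by linarith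
    moreover have "Fp \<rho>s \<le> energy y'" by (rule Fp_le[OF st])
    moreover have "C * \<epsilon> = 2 * (B * (c * \<epsilon>)) + B * (c\<^sup>2 * \<epsilon>) + B * (K * \<epsilon>)"
      by (simp add: C_def algebra_simps)
    moreover have "2 * sqrt \<epsilon> * R \<Psi> = 2 * (sqrt \<epsilon> * R \<Psi>)" by simp
    ultimately show ?thesis using 1 2 3 4 unfolding abs_le_iff by linarith
  qed
  then show ?thesis using \<delta>(1) by blast
qed

section \<open>Passage to the limit\<close>

lemma continuous_R: "continuous_on A R"
  unfolding R_def
proof (intro continuous_intros)
  fix \<omega> assume "\<omega> \<in> \<Omega> - F"
  then have l: "linear (\<lambda>x. Pr \<omega> (W x))"
    using linear_compose[OF W_linear Pr_linear] by (auto simp: o_def)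
  show "continuous_on A (\<lambda>x. Pr \<omega> (W x))"
    using l by (simp add: linear_continuous_on linear_linear)
  show "\<forall>x\<in>A. d \<omega> \<noteq> 0" using d_pos[of \<omega>] \<open>\<omega> \<in> \<Omega> - F\<close> by auto
qed

text \<open>If the bound failed, violating states would accumulate at a state over
  \<open>\<rho>s\<close> whose energy is minimal by continuity, so \<open>R \<le> r\<close> there.
  The local estimate, divided by \<open>sqrt \<epsilon>\<close>, would force
  \<open>2 * r + e \<le> 2 * R\<close> at the same point.\<close>

lemma Fp_lower_bound:
  assumes max: "\<And>\<Phi>. \<Phi> \<in> states \<rho>s \<Longrightarrow> energy \<Phi> = Fp \<rho>s \<Longrightarrow> R \<Phi> \<le> r" and e: "e > 0"
  shows "\<forall>\<^sub>F \<epsilon> in at_right 0. \<forall>\<Psi>\<in>states (\<rho>s + \<epsilon> *\<^sub>R \<eta>). Fp \<rho>s - sqrt \<epsilon> * (2 * r + e) \<le> energy \<Psi>"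
proof (rule ccontr)
  assume "\<not> ?thesis"
  then have "\<exists>\<epsilon>>0. \<epsilon> < b \<and> (\<exists>\<Psi>\<in>states (\<rho>s + \<epsilon> *\<^sub>R \<eta>). energy \<Psi> < Fp \<rho>s - sqrt \<epsilon> * (2 * r + e))"
    if "b > 0" for b
    using that unfolding eventually_at_right_field by (meson not_le)
  then have "\<exists>\<epsilon> \<Psi>. \<epsilon> > 0 \<and> \<epsilon> < inverse (real (Suc n)) \<and> \<Psi> \<in> states (\<rho>s + \<epsilon> *\<^sub>R \<eta>) \<and>
      energy \<Psi> < Fp \<rho>s - sqrt \<epsilon> * (2 * r + e)" for n
    by (meson inverse_positive_iff_positive of_nat_0_less_iff zero_less_Suc)
  then obtain \<epsilon> \<Psi> where en: "\<And>n. \<epsilon> n > 0" "\<And>n. \<epsilon> n < inverse (real (Suc n))"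
    and \<Psi>: "\<And>n. \<Psi> n \<in> states (\<rho>s + \<epsilon> n *\<^sub>R \<eta>)"
    and lt: "\<And>n. energy (\<Psi> n) < Fp \<rho>s - sqrt (\<epsilon> n) * (2 * r + e)" by metis
  have "\<epsilon> \<longlonglongrightarrow> 0"
    by (rule tendsto_sandwich[OF _ _ tendsto_const LIMSEQ_inverse_real_of_nat])
       (use en in \<open>auto intro!: always_eventually less_imp_le\<close>)
  moreover have "\<And>n. \<Psi> n \<in> sphere 0 1" using \<Psi> by (simp add: states_def)
  then obtain \<Phi> s where s: "strict_mono (s :: nat \<Rightarrow> nat)" and lim: "(\<Psi> \<circ> s) \<longlonglongrightarrow> \<Phi>" and n1: "\<Phi> \<in> sphere 0 1"
    using compact_sphere[of 0 1, unfolded compact_def] by metis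
  ultimately have e0: "(\<lambda>n. \<epsilon> (s n)) \<longlonglongrightarrow> 0" using LIMSEQ_subseq_LIMSEQ[of \<epsilon> 0 s] by (simp add: o_def)
  have lim': "(\<lambda>n. \<Psi> (s n)) \<longlonglongrightarrow> \<Phi>" using lim by (simp add: o_def)
  have cont: "(\<lambda>n. f (\<Psi> (s n))) \<longlonglongrightarrow> f \<Phi>" if "continuous_on UNIV f" for f :: "'e \<Rightarrow> 'z::topological_space"
    using continuous_on_tendsto_compose[OF that lim'] by simp
  have "(\<lambda>n. dens (\<Psi> (s n))) \<longlonglongrightarrow> dens \<Phi>" by (intro cont continuous_dens)
  moreover have "(\<lambda>n. dens (\<Psi> (s n))) \<longlonglongrightarrow> \<rho>s"
  proof -
    have "(\<lambda>n. \<rho>s + \<epsilon> (s n) *\<^sub>R \<eta>) \<longlonglongrightarrow> \<rho>s + 0 *\<^sub>R \<eta>" by (intro tendsto_intros e0)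
    then show ?thesis using \<Psi> by (simp add: states_def)
  qed
  ultimately have "dens \<Phi> = \<rho>s" by (rule LIMSEQ_unique)
  with n1 have \<Phi>: "\<Phi> \<in> states \<rho>s" by (simp add: states_def)
  have "energy \<Phi> \<le> Fp \<rho>s"
  proof (rule LIMSEQ_le)
    show "(\<lambda>n. energy (\<Psi> (s n))) \<longlonglongrightarrow> energy \<Phi>" by (intro cont continuous_energy)
    have "(\<lambda>n. Fp \<rho>s - sqrt (\<epsilon> (s n)) * (2 * r + e)) \<longlonglongrightarrow> Fp \<rho>s - sqrt 0 * (2 * r + e)"
      by (intro tendsto_intros e0)
    then show "(\<lambda>n. Fp \<rho>s - sqrt (\<epsilon> (s n)) * (2 * r + e)) \<longlonglongrightarrow> Fp \<rho>s" by simp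
    show "\<exists>N. \<forall>n\<ge>N. energy (\<Psi> (s n)) \<le> Fp \<rho>s - sqrt (\<epsilon> (s n)) * (2 * r + e)"
      using lt less_imp_le by blast
  qed
  with Fp_le[OF \<Phi>] have "R \<Phi> \<le> r" using max[OF \<Phi>] by linarith
  obtain \<delta> C where \<delta>: "\<delta> > 0" and low: "\<And>\<epsilon> \<Psi>. 0 < \<epsilon> \<Longrightarrow> \<epsilon> < \<delta> \<Longrightarrow> \<Psi> \<in> states (\<rho>s + \<epsilon> *\<^sub>R \<eta>) \<Longrightarrow>
      norm (\<Psi> - \<Phi>) < \<delta> \<Longrightarrow> Fp \<rho>s - 2 * sqrt \<epsilon> * R \<Psi> - C * \<epsilon> \<le> energy \<Psi>"
    using energy_lower_bound_near[OF \<Phi>] by metis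
  have "2 * r + e \<le> 2 * R \<Phi>"
  proof (rule LIMSEQ_le_const)
    have "(\<lambda>n. 2 * R (\<Psi> (s n)) + C * sqrt (\<epsilon> (s n))) \<longlonglongrightarrow> 2 * R \<Phi> + C * sqrt 0"
      by (intro tendsto_intros e0 cont continuous_R)
    then show "(\<lambda>n. 2 * R (\<Psi> (s n)) + C * sqrt (\<epsilon> (s n))) \<longlonglongrightarrow> 2 * R \<Phi>" by simp
    have "\<forall>\<^sub>F n in sequentially. \<epsilon> (s n) < \<delta>" using e0 \<delta> by (intro order_tendstoD(2))
    moreover have "\<forall>\<^sub>F n in sequentially. norm (\<Psi> (s n) - \<Phi>) < \<delta>"
      using tendstoD[OF lim' \<delta>] by (simp add: dist_norm)
    ultimately have "\<forall>\<^sub>F n in sequentially. 2 * r + e \<le> 2 * R (\<Psi> (s n)) + C * sqrt (\<epsilon> (s n))"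
    proof eventually_elim
      case (elim n)
      let ?q = "sqrt (\<epsilon> (s n))"
      have "?q * (2 * r + e) < 2 * ?q * R (\<Psi> (s n)) + C * \<epsilon> (s n)"
        using low[OF en(1) elim(1) \<Psi> elim(2)] lt[of "s n"] by linarith
      also have "\<dots> = ?q * (2 * R (\<Psi> (s n)) + C * ?q)"
        using en(1)[of "s n"] by (simp add: algebra_simps)
      finally show ?case using en(1)[of "s n"] by simp
    qed
    then show "\<exists>N. \<forall>n\<ge>N. 2 * r + e \<le> 2 * R (\<Psi> (s n)) + C * sqrt (\<epsilon> (s n))"
      by (simp add: eventually_sequentially)
  qed
  with \<open>R \<Phi> \<le> r\<close> e show False by linarith
qed

text \<open>Minimal right-hand side means maximal \<open>R\<close>, because of the factor -2; the
  maximum exists since the minimizers form a nonempty compact set.\<close>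

lemma best_minimizer_exists:
  obtains \<Phi> where "\<Phi> \<in> states \<rho>s" "energy \<Phi> = Fp \<rho>s"
    "\<And>\<Phi>'. \<Phi>' \<in> states \<rho>s \<Longrightarrow> energy \<Phi>' = Fp \<rho>s \<Longrightarrow> R \<Phi>' \<le> R \<Phi>"
proof -
  let ?M = "states \<rho>s \<inter> energy -` {Fp \<rho>s}"
  have "closed (energy -` {Fp \<rho>s})"
    using continuous_energy[of UNIV]
    by (intro continuous_closed_vimage) (auto simp: continuous_on_eq_continuous_at)
  then have cM: "compact ?M" using compact_states by (rule compact_Int_closed[rotated])
  have nM: "?M \<noteq> {}"
  proof -
    have "states \<rho>s \<noteq> {}" using states_nonempty rho_in F_subset by blast
    then obtain x where "x \<in> states \<rho>s" "energy x = Fp \<rho>s" by (rule minimizer_exists)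
    then show ?thesis by auto
  qed
  obtain \<Phi> where "\<Phi> \<in> ?M" "\<forall>y\<in>?M. R y \<le> R \<Phi>"
    using continuous_attains_sup[OF cM nM continuous_R] by (elim bexE)
  then show thesis using that[of \<Phi>] by auto
qed

lemma Fp_sqrt_expansion:
  assumes \<Phi>: "\<Phi> \<in> states \<rho>s" "energy \<Phi> = Fp \<rho>s"
    and max: "\<And>\<Phi>'. \<Phi>' \<in> states \<rho>s \<Longrightarrow> energy \<Phi>' = Fp \<rho>s \<Longrightarrow> R \<Phi>' \<le> R \<Phi>"
  shows "((\<lambda>\<epsilon>. (Fp (\<rho>s + \<epsilon> *\<^sub>R \<eta>) - Fp \<rho>s) / sqrt \<epsilon>) \<longlongrightarrow> - 2 * R \<Phi>) (at_right 0)"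
proof -
  obtain C where up: "\<forall>\<^sub>F \<epsilon> in at_right 0. states (\<rho>s + \<epsilon> *\<^sub>R \<eta>) \<noteq> {} \<and>
     Fp (\<rho>s + \<epsilon> *\<^sub>R \<eta>) \<le> energy \<Phi> - 2 * sqrt \<epsilon> * R \<Phi> + C * \<epsilon>"
    using Fp_upper_bound[OF \<Phi>(1)] by blast
  have pos: "\<forall>\<^sub>F \<epsilon> in at_right (0::real). 0 < \<epsilon>" by (simp add: eventually_at_right_less)
  show ?thesis
  proof (rule order_tendstoI)
    fix a assume "a < - 2 * R \<Phi>"
    \<comment> \<open>Half the distance from \<open>a\<close> to the limit, so that the lower bound
      still leaves a strict inequality.\<close>
    then have e: "(- 2 * R \<Phi> - a) / 2 > 0" by simp
    have low: "\<forall>\<^sub>F \<epsilon> in at_right 0. \<forall>\<Psi>\<in>states (\<rho>s + \<epsilon> *\<^sub>R \<eta>).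
        Fp \<rho>s - sqrt \<epsilon> * (2 * R \<Phi> + (- 2 * R \<Phi> - a) / 2) \<le> energy \<Psi>"
      using max e by (rule Fp_lower_bound)
    show "\<forall>\<^sub>F \<epsilon> in at_right 0. a < (Fp (\<rho>s + \<epsilon> *\<^sub>R \<eta>) - Fp \<rho>s) / sqrt \<epsilon>"
      using low up pos
    proof eventually_elim
      case (elim \<epsilon>)
      define k where "k = 2 * R \<Phi> + (- 2 * R \<Phi> - a) / 2"
      have "Fp \<rho>s - sqrt \<epsilon> * k \<le> Fp (\<rho>s + \<epsilon> *\<^sub>R \<eta>)"
        unfolding Fp_def[of "\<rho>s + \<epsilon> *\<^sub>R \<eta>"] k_def using elim by (intro cInf_greatest) auto
      then have "- k \<le> (Fp (\<rho>s + \<epsilon> *\<^sub>R \<eta>) - Fp \<rho>s) / sqrt \<epsilon>"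
        using elim(3) by (subst pos_le_divide_eq) (auto simp: mult.commute)
      moreover have "a < - k" using e by (simp add: k_def field_simps)
      ultimately show ?case by (rule less_le_trans[rotated])
    qed
  next
    fix a assume a: "- 2 * R \<Phi> < a"
    have "((\<lambda>\<epsilon>. - 2 * R \<Phi> + C * sqrt \<epsilon>) \<longlongrightarrow> - 2 * R \<Phi> + C * sqrt 0) (at_right 0)"
      by (intro tendsto_intros)
    then have "\<forall>\<^sub>F \<epsilon> in at_right 0. - 2 * R \<Phi> + C * sqrt \<epsilon> < a"
      using a by (intro order_tendstoD(2)) auto
    then show "\<forall>\<^sub>F \<epsilon> in at_right 0. (Fp (\<rho>s + \<epsilon> *\<^sub>R \<eta>) - Fp \<rho>s) / sqrt \<epsilon> < a"
      using up pos
    proof eventually_elim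
      case (elim \<epsilon>)
      have "Fp (\<rho>s + \<epsilon> *\<^sub>R \<eta>) - Fp \<rho>s \<le> (- 2 * R \<Phi> + C * sqrt \<epsilon>) * sqrt \<epsilon>"
        using elim(2,3) \<Phi>(2) by (simp add: algebra_simps)
      then have "(Fp (\<rho>s + \<epsilon> *\<^sub>R \<eta>) - Fp \<rho>s) / sqrt \<epsilon> \<le> - 2 * R \<Phi> + C * sqrt \<epsilon>"
        using elim(3) by (subst pos_divide_le_eq) auto
      then show ?case using elim(1) by linarith
    qed
  qed
qed

end

section \<open>Weight decomposition of an abelian functional theory\<close>

text \<open>The real inner product of \<^typ>\<open>complex^'m\<close> is the real part of the Hermitian one, so the
  Hilbert space can be treated as a real Euclidean space throughout.\<close>

lemma Re_hinner: "Re (hinner x y) = x \<bullet> y"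
  by (simp add: hinner_def inner_vec_def inner_complex_def)

lemma hermitian_selfadjoint:
  fixes A :: "complex^'m^'m"
  assumes "hermitian A"
  shows "(A *v x) \<bullet> y = x \<bullet> (A *v y)"
proof -
  have "hinner (A *v x) y = (\<Sum>i\<in>UNIV. \<Sum>j\<in>UNIV. cnj (A$i$j) * cnj (x$j) * y$i)"
    by (simp add: hinner_def matrix_vector_mult_def sum_distrib_right)
  also have "\<dots> = (\<Sum>j\<in>UNIV. \<Sum>i\<in>UNIV. cnj (A$i$j) * cnj (x$j) * y$i)" by (rule sum.swap)
  also have "\<dots> = (\<Sum>j\<in>UNIV. \<Sum>i\<in>UNIV. cnj (x$j) * (A$j$i * y$i))"
  proof (intro sum.cong refl)
    fix i j
    have "A$j$i = cnj (A$i$j)" using assms unfolding hermitian_def by blast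
    then show "cnj (A$i$j) * cnj (x$j) * y$i = cnj (x$j) * (A$j$i * y$i)" by simp
  qed
  also have "\<dots> = hinner x (A *v y)"
    by (simp add: hinner_def matrix_vector_mult_def sum_distrib_left)
  finally show ?thesis using Re_hinner by metis
qed

lemma complex_of_real_vector_scale: "complex_of_real r *s (x :: complex^'m) = r *\<^sub>R x"
  by (simp add: vec_eq_iff scaleR_conv_of_real[where 'a=complex])

lemma weight_space_iff: "x \<in> weight_space \<iota> \<alpha> \<longleftrightarrow> (\<forall>v. \<iota> v *v x = (\<alpha> \<bullet> v) *\<^sub>R x)"
  by (simp add: weight_space_def complex_of_real_vector_scale)

lemma subspace_weight_space: "subspace (weight_space \<iota> \<alpha>)"
  unfolding subspace_def
  by (auto simp: weight_space_iff matrix_vector_right_distrib scaleR_add_right linear_scale[OF matrix_vector_mul_linear])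

lemma weight_space_ii_scale: "x \<in> weight_space \<iota> \<alpha> \<Longrightarrow> \<i> *s x \<in> weight_space \<iota> \<alpha>"
  by (simp add: weight_space_def vector_scalar_commute vector_smult_assoc mult.commute)

text \<open>A weight space is closed under multiplication by \<open>\<i>\<close>, and testing
  against \<open>\<i> *s y\<close> yields the imaginary part. So complex and real orthogonality to
  it agree.\<close>

lemma hinner_weight_space_zero_iff:
  "(\<forall>y\<in>weight_space \<iota> \<alpha>. hinner y z = 0) \<longleftrightarrow> (\<forall>y\<in>weight_space \<iota> \<alpha>. y \<bullet> z = 0)"
proof
  assume "\<forall>y\<in>weight_space \<iota> \<alpha>. hinner y z = 0"
  then show "\<forall>y\<in>weight_space \<iota> \<alpha>. y \<bullet> z = 0" by (metis Re_hinner zero_complex.simps(1))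
next
  assume *: "\<forall>y\<in>weight_space \<iota> \<alpha>. y \<bullet> z = 0"
  show "\<forall>y\<in>weight_space \<iota> \<alpha>. hinner y z = 0"
  proof
    fix y assume y: "y \<in> weight_space \<iota> \<alpha>"
    have "hinner (\<i> *s y) z = - \<i> * hinner y z"
      by (simp add: hinner_def sum_distrib_left mult.assoc)
    then have "Im (hinner y z) = Re (hinner (\<i> *s y) z)" by simp
    then show "hinner y z = 0"
      using * y weight_space_ii_scale[OF y] by (simp add: complex_eq_iff Re_hinner)
  qed
qed

text \<open>Existence and uniqueness of the orthogonal projection justify the definite description.
  The last clause is the tool for verifying later identities.\<close>

lemma weight_proj_props:
  shows "weight_proj \<iota> \<omega> x \<in> weight_space \<iota> \<omega>"
    and "y \<in> weight_space \<iota> \<omega> \<Longrightarrow> y \<bullet> (x - weight_proj \<iota> \<omega> x) = 0"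
    and "p \<in> weight_space \<iota> \<omega> \<Longrightarrow> (\<And>y. y \<in> weight_space \<iota> \<omega> \<Longrightarrow> y \<bullet> (x - p) = 0) \<Longrightarrow> weight_proj \<iota> \<omega> x = p"
proof -
  let ?V = "weight_space \<iota> \<omega>"
  let ?Q = "\<lambda>p. p \<in> ?V \<and> (\<forall>y\<in>?V. y \<bullet> (x - p) = 0)"
  have sp: "span ?V = ?V" by (simp add: subspace_weight_space)
  obtain u w where uw: "u \<in> span ?V" "\<And>v. v \<in> span ?V \<Longrightarrow> orthogonal w v" "x = u + w"
    using orthogonal_subspace_decomp_exists[of ?V x] by metis
  have Qu: "?Q u" using uw by (auto simp: sp orthogonal_def inner_commute)
  have uniq: "p = q" if "?Q p" "?Q q" for p q
  proof -
    have "p - q \<in> ?V" using that by (simp add: subspace_diff subspace_weight_space)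
    then have "(p - q) \<bullet> (x - q) = 0" "(p - q) \<bullet> (x - p) = 0" using that by auto
    then have "(p - q) \<bullet> (p - q) = 0" by (simp add: inner_diff_right)
    then show "p = q" by simp
  qed
  have wp: "weight_proj \<iota> \<omega> x = (THE p. ?Q p)"
    unfolding weight_proj_def hinner_weight_space_zero_iff ..
  have Q: "?Q (weight_proj \<iota> \<omega> x)"
    unfolding wp by (rule theI[of ?Q, OF Qu]) (rule uniq[OF _ Qu])
  then show "weight_proj \<iota> \<omega> x \<in> ?V" "y \<in> ?V \<Longrightarrow> y \<bullet> (x - weight_proj \<iota> \<omega> x) = 0" by auto
  show "p \<in> ?V \<Longrightarrow> (\<And>y. y \<in> ?V \<Longrightarrow> y \<bullet> (x - p) = 0) \<Longrightarrow> weight_proj \<iota> \<omega> x = p"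
    using uniq[OF Q, of p] by blast
qed

text \<open>The operator at \<open>\<alpha> - \<beta>\<close> separates the two spaces: its
  eigenvalues there differ by the squared norm of \<open>\<alpha> - \<beta>\<close>.\<close>

lemma weight_spaces_orthogonal:
  assumes thy: "functional_theory \<iota> W"
    and x: "x \<in> weight_space \<iota> \<alpha>" and y: "y \<in> weight_space \<iota> \<beta>" and ne: "\<alpha> \<noteq> \<beta>"
  shows "x \<bullet> y = 0"
proof -
  let ?v = "\<alpha> - \<beta>"
  have "(\<iota> ?v *v x) \<bullet> y = x \<bullet> (\<iota> ?v *v y)"
    using thy by (intro hermitian_selfadjoint) (simp add: functional_theory_def)
  then have "((\<alpha> - \<beta>) \<bullet> ?v) * (x \<bullet> y) = 0"
    using x y unfolding weight_space_iff by (simp add: inner_diff_left algebra_simps)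
  then show ?thesis using ne by simp
qed

text \<open>One nonzero vector per weight gives an orthogonal, hence independent, family in a
  finite-dimensional space.\<close>

lemma finite_weights_of_theory:
  fixes \<iota> :: "real^'n \<Rightarrow> complex^'m^'m"
  assumes thy: "functional_theory \<iota> W"
  shows "finite (weights \<iota>)"
proof -
  have "\<exists>x\<in>weight_space \<iota> \<alpha>. x \<noteq> 0" if "\<alpha> \<in> weights \<iota>" for \<alpha>
    using that subspace_weight_space[of \<iota> \<alpha>] subspace_0 unfolding weights_def by blast
  then obtain e where e: "\<And>\<alpha>. \<alpha> \<in> weights \<iota> \<Longrightarrow> e \<alpha> \<in> weight_space \<iota> \<alpha> \<and> e \<alpha> \<noteq> 0" by metis
  have orth: "e \<alpha> \<bullet> e \<beta> = 0" if "\<alpha> \<in> weights \<iota>" "\<beta> \<in> weights \<iota>" "\<alpha> \<noteq> \<beta>" for \<alpha> \<beta>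
    using weight_spaces_orthogonal[OF thy _ _ that(3)] e that by blast
  have "inj_on e (weights \<iota>)"
    by (rule inj_onI) (metis e inner_eq_zero_iff orth)
  moreover have "independent (e ` weights \<iota>)"
  proof (rule pairwise_orthogonal_independent)
    show "pairwise orthogonal (e ` weights \<iota>)"
      unfolding pairwise_def orthogonal_def using orth by fastforce
    show "0 \<notin> e ` weights \<iota>" using e by force
  qed
  then have "finite (e ` weights \<iota>)" by (rule independent_imp_finite)
  ultimately show ?thesis by (simp add: finite_image_iff)
qed

text \<open>Completeness of the decomposition: the common orthogonal complement is invariant, so if
  nonzero it contains a joint eigenvector. That vector lies in a weight space and is thus orthogonal
  to itself.\<close>

lemma orthogonal_to_weight_spaces_zero:
  fixes \<iota> :: "real^'n \<Rightarrow> complex^'m^'m"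
  assumes thy: "functional_theory \<iota> W" and ab: "abelian \<iota>"
    and x: "\<And>\<alpha> y. y \<in> weight_space \<iota> \<alpha> \<Longrightarrow> y \<bullet> x = 0"
  shows "x = 0"
proof (rule ccontr)
  assume nz: "x \<noteq> 0"
  have lin: "linear \<iota>" and herm: "\<And>v. hermitian (\<iota> v)" using thy by (auto simp: functional_theory_def)
  note sa = hermitian_selfadjoint[OF herm]
  define U where "U = {x. \<forall>\<alpha>. \<forall>y\<in>weight_space \<iota> \<alpha>. y \<bullet> x = 0}"
  have "\<exists>\<alpha>. \<exists>z\<in>U. z \<noteq> 0 \<and> (\<forall>v. \<iota> v *v z = (\<alpha> \<bullet> v) *\<^sub>R z)"
  proof (rule commuting_selfadjoint_joint_eigenvector[of "\<lambda>v x. \<iota> v *v x"])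
    show "linear (\<lambda>x. \<iota> v *v x)" for v by simp
    show "linear (\<lambda>v. \<iota> v *v x)" for x
    proof
      fix v w and r :: real
      show "\<iota> (v + w) *v x = \<iota> v *v x + \<iota> w *v x"
        by (simp add: linear_add[OF lin] matrix_vector_mult_add_rdistrib)
      show "\<iota> (r *\<^sub>R v) *v x = r *\<^sub>R (\<iota> v *v x)"
        by (simp add: linear_scale[OF lin] vec_eq_iff matrix_vector_mult_def scaleR_sum_right)
    qed
    show "(\<iota> v *v x) \<bullet> y = x \<bullet> (\<iota> v *v y)" for v x y by (rule sa)
    show "\<iota> v *v (\<iota> w *v x) = \<iota> w *v (\<iota> v *v x)" for v w x
      using ab by (simp add: abelian_def matrix_vector_mul_assoc)
    show "subspace U" by (auto simp: U_def subspace_def inner_add_right)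
    show "U \<noteq> {0}" using x nz by (auto simp: U_def)
    show "(\<lambda>x. \<iota> v *v x) ` U \<subseteq> U" for v
    proof (clarsimp simp: U_def)
      fix z \<alpha> y
      assume z: "\<forall>\<alpha>. \<forall>y\<in>weight_space \<iota> \<alpha>. y \<bullet> z = 0" and y: "y \<in> weight_space \<iota> \<alpha>"
      have "y \<bullet> (\<iota> v *v z) = (\<iota> v *v y) \<bullet> z" by (simp add: sa)
      also have "\<dots> = (\<alpha> \<bullet> v) * (y \<bullet> z)" using y by (simp add: weight_space_iff)
      also have "\<dots> = 0" using y z by simp
      finally show "y \<bullet> (\<iota> v *v z) = 0" .
    qed
  qed
  then obtain \<alpha> z where "z \<in> U" "z \<noteq> 0" "z \<in> weight_space \<iota> \<alpha>" by (auto simp: weight_space_iff)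
  moreover from this have "z \<bullet> z = 0" unfolding U_def by blast
  ultimately show False by simp
qed

lemma weight_resolution_of_theory:
  fixes \<iota> :: "real^'n \<Rightarrow> complex^'m^'m"
  assumes thy: "functional_theory \<iota> W" and ab: "abelian \<iota>"
  shows "weight_resolution (weights \<iota>) (weight_proj \<iota>) (\<lambda>x. W *v x)"
proof (rule weight_resolution.intro)
  show "finite (weights \<iota>)" by (rule finite_weights_of_theory[OF thy])
  note wp = weight_proj_props[where \<iota> = \<iota>]
  show "linear (weight_proj \<iota> \<omega>)" for \<omega>
  proof
    fix x y and r :: real
    show "weight_proj \<iota> \<omega> (x + y) = weight_proj \<iota> \<omega> x + weight_proj \<iota> \<omega> y"
    proof (rule wp(3))
      show "weight_proj \<iota> \<omega> x + weight_proj \<iota> \<omega> y \<in> weight_space \<iota> \<omega>"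
        by (intro subspace_add[OF subspace_weight_space] wp)
      fix z assume "z \<in> weight_space \<iota> \<omega>"
      from wp(2)[OF this, of x] wp(2)[OF this, of y]
      show "z \<bullet> (x + y - (weight_proj \<iota> \<omega> x + weight_proj \<iota> \<omega> y)) = 0" by (simp add: inner_simps)
    qed
    show "weight_proj \<iota> \<omega> (r *\<^sub>R x) = r *\<^sub>R weight_proj \<iota> \<omega> x"
    proof (rule wp(3))
      show "r *\<^sub>R weight_proj \<iota> \<omega> x \<in> weight_space \<iota> \<omega>"
        by (intro subspace_scale[OF subspace_weight_space] wp)
      fix z assume "z \<in> weight_space \<iota> \<omega>"
      from wp(2)[OF this, of x]
      show "z \<bullet> (r *\<^sub>R x - r *\<^sub>R weight_proj \<iota> \<omega> x) = 0" by (simp add: inner_simps)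
    qed
  qed
  show "weight_proj \<iota> \<omega> x \<bullet> y = x \<bullet> weight_proj \<iota> \<omega> y" for \<omega> x y
    using wp(2)[OF wp(1)[of \<omega> x], of y] wp(2)[OF wp(1)[of \<omega> y], of x]
    by (simp add: inner_diff_right inner_commute)
  show "weight_proj \<iota> \<omega> (weight_proj \<iota> \<omega> x) = weight_proj \<iota> \<omega> x" for \<omega> x
    by (rule wp(3)) (auto intro: wp)
  show "weight_proj \<iota> \<omega> (weight_proj \<iota> \<omega>' x) = 0" if "\<omega> \<noteq> \<omega>'" for \<omega> \<omega>' x
    using weight_spaces_orthogonal[OF thy _ wp(1) that]
    by (intro wp(3)) (auto simp: subspace_0[OF subspace_weight_space])
  show "\<exists>x. weight_proj \<iota> \<omega> x \<noteq> 0" if \<omega>: "\<omega> \<in> weights \<iota>" for \<omega>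
  proof -
    obtain x where x: "x \<in> weight_space \<iota> \<omega>" "x \<noteq> 0"
      using \<omega> subspace_0[OF subspace_weight_space[of \<iota> \<omega>]] unfolding weights_def by blast
    have "weight_proj \<iota> \<omega> x = x" by (rule wp(3)) (use x in auto)
    with x show ?thesis by metis
  qed
  show "(\<Sum>\<omega>\<in>weights \<iota>. weight_proj \<iota> \<omega> x) = x" for x
  proof -
    have "x - (\<Sum>\<omega>\<in>weights \<iota>. weight_proj \<iota> \<omega> x) = 0"
    proof (rule orthogonal_to_weight_spaces_zero[OF thy ab])
      fix \<alpha> y assume y: "y \<in> weight_space \<iota> \<alpha>"
      show "y \<bullet> (x - (\<Sum>\<omega>\<in>weights \<iota>. weight_proj \<iota> \<omega> x)) = 0"
      \<comment> \<open>If \<open>\<alpha>\<close> is not a weight, its space is \<open>{0}\<close>;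
        the case \<open>y = 0\<close> absorbs this.\<close>
      proof (cases "y = 0")
        case False
        then have \<alpha>: "\<alpha> \<in> weights \<iota>" using y by (auto simp: weights_def)
        have "y \<bullet> (\<Sum>\<omega>\<in>weights \<iota>. weight_proj \<iota> \<omega> x)
            = (\<Sum>\<omega>\<in>weights \<iota>. if \<omega> = \<alpha> then y \<bullet> weight_proj \<iota> \<alpha> x else 0)"
          unfolding inner_sum_right
          using weight_spaces_orthogonal[OF thy y wp(1)] by (intro sum.cong) auto
        also have "\<dots> = y \<bullet> weight_proj \<iota> \<alpha> x"
          using \<alpha> finite_weights_of_theory[OF thy] by simp
        finally show ?thesis using wp(2)[OF y, of x] by (simp add: inner_diff_right)
      qed simp
    qed
    then show ?thesis by simp
  qed
  show "linear (\<lambda>x. W *v x)" by simp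
  show "(W *v x) \<bullet> y = x \<bullet> (W *v y)" for x y
    using thy by (intro hermitian_selfadjoint) (simp add: functional_theory_def)
qed

text \<open>On each component \<open>\<iota> v\<close> acts as the scalar
  \<open>\<omega> \<bullet> v\<close>, so its expectation is the pairing of \<open>v\<close> with
  \<open>dens \<Psi>\<close>; testing with all \<open>v\<close> determines the density.\<close>

lemma represents_iff_dens:
  fixes \<iota> :: "real^'n \<Rightarrow> complex^'m^'m"
  assumes thy: "functional_theory \<iota> W" and ab: "abelian \<iota>"
  shows "represents \<iota> \<Psi> \<rho> \<longleftrightarrow> weight_resolution.dens (weights \<iota>) (weight_proj \<iota>) \<Psi> = \<rho>"
proof -
  interpret weight_resolution "weights \<iota>" "weight_proj \<iota>" "\<lambda>x. W *v x"
    by (rule weight_resolution_of_theory[OF thy ab])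
  have "Re (hinner \<Psi> (\<iota> v *v \<Psi>)) = dens \<Psi> \<bullet> v" for v
  proof -
    have "\<iota> v *v \<Psi> = (\<Sum>\<omega>\<in>weights \<iota>. \<iota> v *v weight_proj \<iota> \<omega> \<Psi>)"
      by (subst sum_Pr[of \<Psi>, symmetric]) (simp add: linear_sum[OF matrix_vector_mul_linear])
    also have "\<dots> = (\<Sum>\<omega>\<in>weights \<iota>. (\<omega> \<bullet> v) *\<^sub>R weight_proj \<iota> \<omega> \<Psi>)"
      using weight_proj_props(1) by (intro sum.cong) (auto simp: weight_space_iff)
    finally have "\<Psi> \<bullet> (\<iota> v *v \<Psi>) = (\<Sum>\<omega>\<in>weights \<iota>. (\<omega> \<bullet> v) * (\<Psi> \<bullet> weight_proj \<iota> \<omega> \<Psi>))"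
      by (simp add: inner_sum_right)
    also have "\<dots> = dens \<Psi> \<bullet> v"
      unfolding dens_inner by (intro sum.cong) (auto simp: inner_Pr[of _ \<Psi> \<Psi>] power2_norm_eq_inner)
    finally show ?thesis by (simp add: Re_hinner)
  qed
  then show ?thesis unfolding represents_def by (metis vector_eq_ldot inner_commute)
qed

theorem theorem4p20:
  fixes \<iota> :: "real^'n \<Rightarrow> complex^'m^'m" and W :: "complex^'m^'m"
    and F :: "(real^'n) set" and \<rho>s \<eta> S \<gamma> :: "real^'n"
  assumes thy: "functional_theory \<iota> W"
    and ab: "abelian \<iota>"
    and facet: "F facet_of convex hull (weights \<iota>)"
    and rho_in: "\<rho>s \<in> F"
    and rho_generic: "\<forall>T. T \<subseteq> weights \<iota> \<inter> F \<and> finite T \<and> card T \<le> nat (aff_dim F)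
                        \<longrightarrow> \<rho>s \<notin> convex hull T"
    and eta_dir: "\<eta> \<in> translation_space (affine hull (weights \<iota>))"
    and eta_inward: "\<forall>\<^sub>F \<epsilon> in at_right 0. \<rho>s + \<epsilon> *\<^sub>R \<eta> \<in> convex hull (weights \<iota>)"
    and S_perp: "\<forall>\<alpha>\<in>translation_space (affine hull F). \<alpha> \<bullet> S = 0"
    and S_eta: "\<eta> \<bullet> S = 1"
    and gamma: "\<gamma> \<in> affine hull F"
  shows "\<exists>\<Phi>. pure_minimizer \<iota> W \<rho>s \<Phi> \<and>
    (let rhs = (\<lambda>\<Phi>. - 2 * sqrt (\<Sum>\<omega>\<in>weights \<iota> - weights \<iota> \<inter> F.
                 (norm (weight_proj \<iota> \<omega> (W *v \<Phi>)))\<^sup>2 / (\<omega> \<bullet> S - \<gamma> \<bullet> S)))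
     in (\<forall>\<Phi>'. pure_minimizer \<iota> W \<rho>s \<Phi>' \<longrightarrow> rhs \<Phi> \<le> rhs \<Phi>') \<and>
        ((\<lambda>\<epsilon>. (pure_functional \<iota> W (\<rho>s + \<epsilon> *\<^sub>R \<eta>) - pure_functional \<iota> W \<rho>s) / sqrt \<epsilon>)
           \<longlongrightarrow> rhs \<Phi>) (at_right 0))"
proof -
  interpret weight_resolution "weights \<iota>" "weight_proj \<iota>" "\<lambda>x. W *v x"
    by (rule weight_resolution_of_theory[OF thy ab])
  interpret facet_resolution "weights \<iota>" "weight_proj \<iota>" "\<lambda>x. W *v x" F \<rho>s \<eta> S \<gamma>
  proof
    show "\<rho>s \<notin> convex hull T" if "T \<subseteq> weights \<iota> \<inter> F" "card T \<le> nat (aff_dim F)" for T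
      using rho_generic that finite_weights by (meson finite_Int finite_subset)
  qed (use facet rho_in eta_dir eta_inward S_perp S_eta gamma in auto)
  have st: "norm \<Psi> = 1 \<and> represents \<iota> \<Psi> \<rho> \<longleftrightarrow> \<Psi> \<in> states \<rho>" for \<Psi> \<rho>
    by (simp add: states_def represents_iff_dens[OF thy ab])
  have pf: "pure_functional \<iota> W \<rho> = Fp \<rho>" for \<rho>
    unfolding pure_functional_def Fp_def st Re_hinner energy_def
    by (rule arg_cong[where f=Inf]) auto
  have pm: "pure_minimizer \<iota> W \<rho>s \<Psi> \<longleftrightarrow> \<Psi> \<in> states \<rho>s \<and> energy \<Psi> = Fp \<rho>s" for \<Psi>
    unfolding pure_minimizer_def pf using st[of \<Psi> \<rho>s] by (auto simp: Re_hinner energy_def)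
  have rhs: "sqrt (\<Sum>\<omega>\<in>weights \<iota> - weights \<iota> \<inter> F.
      (norm (weight_proj \<iota> \<omega> (W *v \<Psi>)))\<^sup>2 / (\<omega> \<bullet> S - \<gamma> \<bullet> S)) = R \<Psi>" for \<Psi>
    by (simp add: R_def d_def Diff_Int)
  obtain \<Phi> where \<Phi>: "\<Phi> \<in> states \<rho>s" "energy \<Phi> = Fp \<rho>s"
    "\<And>\<Phi>'. \<Phi>' \<in> states \<rho>s \<Longrightarrow> energy \<Phi>' = Fp \<rho>s \<Longrightarrow> R \<Phi>' \<le> R \<Phi>"
    using best_minimizer_exists by blast
  have "((\<lambda>\<epsilon>. (Fp (\<rho>s + \<epsilon> *\<^sub>R \<eta>) - Fp \<rho>s) / sqrt \<epsilon>) \<longlongrightarrow> - 2 * R \<Phi>) (at_right 0)"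
    using \<Phi> by (rule Fp_sqrt_expansion)
  then show ?thesis
    unfolding Let_def rhs pf pm using \<Phi> by (intro exI[of _ \<Phi>]) auto
qed

end
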